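(* There is a sufficiently large constant $C>0$ such that the following holds. (a) For 3-Majority started from any initial configuration with $\gamma_0\ge C\log n/\sqrt n$, the consensus time is $O(\log n/\gamma_0)$ with high probability. (b) For 2-Choices started from any initial configuration with $\gamma_0\ge C(\log n)^2/n$, the consensus time is $O(\log n/\gamma_0)$ with high probability.
   Context: **Setting.** Let $V$ be a set of $n$ vertices and $k\in\{1,\dots,n\}$. A configuration is a map $\mathsf{opn}\colon V\to[k]=\{1,\dots,k\}$. The process is synchronous: each round $t\ge1$ produces $\mathsf{opn}_t$ from $\mathsf{opn}_{t-1}$, and all vertices make their choices independently. **3-Majority.** Each vertex $v$ samples $w_1,w_2,w_3\in V$ independently and uniformly, with replacement. It sets $\mathsf{opn}_t(v)=\mathsf{opn}_{t-1}(w_1)$ if $\mathsf{opn}_{t-1}(w_1)=\mathsf{opn}_{t-1}(w_2)$, and $\mathsf{opn}_t(v)=\mathsf{opn}_{t-1}(w_3)$ otherwise. **2-Choices.** Each vertex $v$ samples $w_1,w_2\in V$ independently and uniformly, with replacement. It sets $\mathsf{opn}_t(v)=\mathsf{opn}_{t-1}(w_1)$ if $\mathsf{opn}_{t-1}(w_1)=\mathsf{opn}_{t-1}(w_2)$, and $\mathsf{opn}_t(v)=\mathsf{opn}_{t-1}(v)$ otherwise. **Basic quantities.** - $\alpha_t(i)=|\{v:\mathsf{opn}_t(v)=i\}|/n$ is the fraction of vertices holding opinion $i$. - $\gamma_t=\sum_{i\in[k]}\alpha_t(i)^2$. - The consensus time is $\tau_{\mathrm{cons}}=\inf\{t\ge0:\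 \exists i\ \forall v,\ \mathsf{opn}_t(v)=i\}$. **Conventions.** "With high probability" means with probability $1-O(n^{-c})$ for some constant $c>0$, as $n\to\infty$. Hidden constants are independent of $n$, $k$ and the initial configuration. *)

theory Defs
  imports "HOL-Probability.Probability"
begin

(* Vertices V = {0..<n}; opinions [k] = {1..k}; a configuration is a map nat => nat
   whose values on V matter (outside V it is irrelevant; the step sets it to 0). *)
type_synonym config = "nat \<Rightarrow> nat"

definition alpha :: "nat \<Rightarrow> config \<Rightarrow> nat \<Rightarrow> real" where
  "alpha n c i = real (card {v\<in>{..<n}. c v = i}) / real n"

definition gamma :: "nat \<Rightarrow> nat \<Rightarrow> config \<Rightarrow> real" where
  "gamma n k c = (\<Sum>i\<in>{1..k}. (alpha n c i)^2)"

definition is_consensus :: "nat \<Rightarrow> nat \<Rightarrow> config \<Rightarrow> bool" where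
  "is_consensus n k c \<longleftrightarrow> (\<exists>i\<in>{1..k}. \<forall>v<n. c v = i)"

definition unif_vertex :: "nat \<Rightarrow> nat pmf" where
  "unif_vertex n = pmf_of_set {..<n}"

definition three_maj_vertex :: "nat \<Rightarrow> config \<Rightarrow> nat \<Rightarrow> nat pmf" where
  "three_maj_vertex n c v =
     map_pmf (\<lambda>(w1, w2, w3). if c w1 = c w2 then c w1 else c w3)
       (pair_pmf (unif_vertex n) (pair_pmf (unif_vertex n) (unif_vertex n)))"

definition two_choices_vertex :: "nat \<Rightarrow> config \<Rightarrow> nat \<Rightarrow> nat pmf" where
  "two_choices_vertex n c v =
     map_pmf (\<lambda>(w1, w2). if c w1 = c w2 then c w1 else c v)
       (pair_pmf (unif_vertex n) (unif_vertex n))"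

definition sync_step :: "nat \<Rightarrow> (nat \<Rightarrow> config \<Rightarrow> nat \<Rightarrow> nat pmf) \<Rightarrow> config \<Rightarrow> config pmf" where
  "sync_step n rule c = Pi_pmf {..<n} 0 (\<lambda>v. rule n c v)"

fun trajectory :: "nat \<Rightarrow> (nat \<Rightarrow> config \<Rightarrow> nat \<Rightarrow> nat pmf) \<Rightarrow> config \<Rightarrow> nat \<Rightarrow> config list pmf" where
  "trajectory n rule c0 0 = return_pmf [c0]"
| "trajectory n rule c0 (Suc t) =
     bind_pmf (trajectory n rule c0 t)
       (\<lambda>xs. map_pmf (\<lambda>c. xs @ [c]) (sync_step n rule (last xs)))"

definition prob_cons_by :: "nat \<Rightarrow> nat \<Rightarrow> (nat \<Rightarrow> config \<Rightarrow> nat \<Rightarrow> nat pmf) \<Rightarrow> config \<Rightarrow> nat \<Rightarrow> real" where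
  "prob_cons_by n k rule c0 T =
     measure_pmf.prob (trajectory n rule c0 T) {xs. \<exists>t\<le>T. is_consensus n k (xs ! t)}"

end

theory Submission
  imports Defs
begin

text \<open>
  Split the run into phases in which \<open>gamma\<close> grows by a factor \<open>6/5\<close>; let \<open>g\<close> be its value at the start of
  a phase. In both models \<open>E[\<alpha>'(i)] = \<alpha>(i) (1 + \<alpha>(i) - gamma)\<close>, and the noise of \<open>\<alpha>'(i)\<close> has variance of
  order \<open>g * w / n\<close> when \<open>\<alpha>(i)\<close> is of order \<open>g\<close>, with \<open>w = 1\<close> for 3-Majority and \<open>w = g\<close> for 2-Choices.
  The assumption on \<open>gamma\<close> says that \<open>n * g\<^sup>2 / w\<close> is a large multiple of \<open>(ln n)\<^sup>2\<close>.

  By convexity \<open>gamma'\<close> is bounded below by a sum of independent variables with mean at least \<open>gamma\<close>,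
  so an exponential moment shows that \<open>gamma\<close> stays above \<open>0.95 * g\<close> during a phase of \<open>O(ln n / g)\<close> rounds.
  For two opinions \<open>i\<close>, \<open>j\<close> consider the minimum of (multiples of) the potentials
  \<open>exp (\<lambda> * \<alpha>(i)) - 1\<close>, which contracts when \<open>\<alpha>(i) \<le> 0.8 * g\<close>;
  \<open>1 / (K * n * w + (n * \<alpha>(i) - n * \<alpha>(j))\<^sup>2)\<close>, which contracts when \<open>\<alpha>(i)\<close> and \<open>\<alpha>(j)\<close> are between \<open>0.7 * g\<close> and
  \<open>2 * g\<close>; and \<open>exp (- \<lambda> * \<alpha>(i))\<close> plus a correction, which contracts when \<open>\<alpha>(i) \<ge> 1.5 * g\<close>; likewise for \<open>j\<close>.
  With \<open>\<lambda>\<close> of order \<open>ln n / g\<close> the multiples can be chosen so that whichever potential attains the minimum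
  contracts by a factor \<open>1 - const * g\<close>. Hence so does the minimum, whose values are between \<open>1 / n\<close> and a
  power of \<open>n\<close> while both opinions are alive, so after \<open>O(ln n / g)\<close> rounds one of them is extinct.
\<close>

section \<open>Expectations and independent sums\<close>

abbreviation E :: "'a pmf \<Rightarrow> ('a \<Rightarrow> real) \<Rightarrow> real" where
  "E p f \<equiv> measure_pmf.expectation p f"

text \<open>All laws below have finite support, which serves in place of integrability
  throughout.\<close>

lemma E_bind:
  assumes "finite (set_pmf p)" "\<And>x. x \<in> set_pmf p \<Longrightarrow> finite (set_pmf (f x))"
  shows "E (bind_pmf p f) h = E p (\<lambda>x. E (f x) h)"
proof -
  have "E (bind_pmf p f) h = (\<Sum>a\<in>set_pmf p. pmf p a *\<^sub>R E (f a) h)"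
    using assms by (intro pmf_expectation_bind) auto
  also have "\<dots> = E p (\<lambda>x. E (f x) h)"
    using assms by (subst integral_measure_pmf[of "set_pmf p"]) auto
  finally show ?thesis .
qed

lemma E_pair:
  assumes "finite (set_pmf p)" "finite (set_pmf q)"
  shows "E (pair_pmf p q) h = E p (\<lambda>x. E q (\<lambda>y. h (x, y)))"
  unfolding pair_pmf_def using assms by (simp add: E_bind)

lemma E_mono:
  assumes "finite (set_pmf p)" "\<And>x. x \<in> set_pmf p \<Longrightarrow> f x \<le> g x"
  shows "E p f \<le> E p g"
  using assms by (intro integral_mono_AE) (auto intro: integrable_measure_pmf_finite simp: AE_measure_pmf_iff)

lemma E_cong:
  assumes "\<And>x. x \<in> set_pmf p \<Longrightarrow> f x = g x"
  shows "E p f = E p g"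
  using assms by (intro integral_cong_AE) (auto simp: AE_measure_pmf_iff)

lemma E_const_le:
  assumes "finite (set_pmf p)" "\<And>x. x \<in> set_pmf p \<Longrightarrow> f x \<le> b"
  shows "E p f \<le> b"
  using E_mono[OF assms(1), of f "\<lambda>_. b"] assms(2) by simp

lemma E_add: "finite (set_pmf p) \<Longrightarrow> E p (\<lambda>x. f x + g x) = E p f + E p g"
  by (simp add: integrable_measure_pmf_finite)

lemma E_diff: "finite (set_pmf p) \<Longrightarrow> E p (\<lambda>x. f x - g x) = E p f - E p g"
  by (simp add: integrable_measure_pmf_finite)

lemma E_sum: "finite (set_pmf p) \<Longrightarrow> E p (\<lambda>x. \<Sum>i\<in>I. f i x) = (\<Sum>i\<in>I. E p (f i))"
  by (rule Bochner_Integration.integral_sum) (simp add: integrable_measure_pmf_finite)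

lemma finite_set_Pi_pmf:
  assumes "finite A" "\<And>v. v \<in> A \<Longrightarrow> finite (set_pmf (p v))"
  shows "finite (set_pmf (Pi_pmf A d p))"
  using assms by (simp add: set_Pi_pmf finite_PiE_dflt)

lemma E_Pi_insert:
  assumes "finite A" "x \<notin> A" "\<And>v. v \<in> insert x A \<Longrightarrow> finite (set_pmf (p v))"
  shows "E (Pi_pmf (insert x A) d p) h = E (p x) (\<lambda>a. E (Pi_pmf A d p) (\<lambda>f. h (f(x := a))))"
proof -
  have fin: "finite (set_pmf (Pi_pmf A d p))" "finite (set_pmf (p x))"
    using assms by (auto intro: finite_set_Pi_pmf)
  show ?thesis
    unfolding Pi_pmf_insert'[OF assms(1,2)]
    by (subst E_bind) (use fin in \<open>auto simp: E_bind\<close>)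
qed

lemma E_Pi_component:
  assumes "finite A" "v \<in> A"
  shows "E (Pi_pmf A d p) (\<lambda>y. h (y v)) = E (p v) h"
proof -
  have "E (p v) h = E (map_pmf (\<lambda>y. y v) (Pi_pmf A d p)) h"
    using assms by (simp add: Pi_pmf_component)
  then show ?thesis by simp
qed

lemma E_Pi_sum:
  assumes "finite A" "\<And>v. v \<in> A \<Longrightarrow> finite (set_pmf (p v))"
  shows "E (Pi_pmf A d p) (\<lambda>y. \<Sum>v\<in>A. f v (y v)) = (\<Sum>v\<in>A. E (p v) (f v))"
  using assms by (simp add: E_sum finite_set_Pi_pmf E_Pi_component)

section \<open>Variances, in particular of indicators and their differences\<close>

definition Var :: "'a pmf \<Rightarrow> ('a \<Rightarrow> real) \<Rightarrow> real" where
  "Var p f = E p (\<lambda>x. (f x - E p f)^2)"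

lemma Var_eq:
  assumes "finite (set_pmf p)"
  shows "Var p f = E p (\<lambda>x. (f x)^2) - (E p f)^2"
proof -
  define m where "m = E p f"
  have "Var p f = E p (\<lambda>x. (f x)^2 - 2 * m * f x + m^2)"
    unfolding Var_def m_def[symmetric] by (simp add: power2_eq_square algebra_simps)
  also have "\<dots> = E p (\<lambda>x. (f x)^2) - 2 * m * E p f + m^2"
    using assms by (simp add: E_add E_diff)
  finally show ?thesis by (simp add: m_def power2_eq_square)
qed

lemma Var_scale: "Var p (\<lambda>x. c * f x) = c^2 * Var p f"
proof -
  have "(c * f x - c * E p f)\<^sup>2 = c^2 * (f x - E p f)^2" for x
    by (simp add: power_mult_distrib flip: right_diff_distrib)
  then show ?thesis unfolding Var_def by simp
qed

text \<open>The mean minimises the mean squared distance. The centre \<open>x\<close> is later 0 or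
  the \<open>alpha\<close> value of a vertex's own opinion.\<close>

lemma Var_le:
  assumes "finite (set_pmf p)"
  shows "Var p f \<le> E p (\<lambda>z. (f z - x)^2)"
proof -
  define m where "m = E p f"
  have "E p (\<lambda>z. (f z - x)^2) = E p (\<lambda>z. (f z)^2 - 2 * x * f z + x^2)"
    by (simp add: power2_eq_square algebra_simps)
  also have "\<dots> = E p (\<lambda>z. (f z)^2) - 2 * x * m + x^2"
    using assms by (simp add: E_add E_diff m_def)
  also have "\<dots> = Var p f + (m - x)^2"
    using assms by (simp add: Var_eq m_def power2_eq_square algebra_simps)
  finally show ?thesis by simp
qed

lemma E_of_bool: "E p (\<lambda>z. of_bool (z = i)) = pmf p i"
proof -
  have "E p (\<lambda>z. of_bool (z = i)) = E p (indicator {i})"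
    by (rule E_cong) (auto simp: indicator_def)
  then show ?thesis by (simp add: measure_pmf_single)
qed

lemma abs_of_bool_diff: "\<bar>of_bool b - pmf p x\<bar> \<le> 1"
  using pmf_le_1[of p x] by (cases b) auto

lemma Var_of_bool:
  assumes "finite (set_pmf p)"
  shows "Var p (\<lambda>z. of_bool (z = i)) = pmf p i * (1 - pmf p i)"
proof -
  have "(\<lambda>z. (of_bool (z = i) :: real)^2) = (\<lambda>z. of_bool (z = i))" by auto
  then show ?thesis
    by (simp only: Var_eq[OF assms] E_of_bool) (simp add: power2_eq_square algebra_simps)
qed

text \<open>The variance is \<open>A * (1 - A) + B * (1 - B) + 2 * (A * B)\<close>. Dropping terms
  gives the lower bound; \<open>A + B \<le> 1\<close> bounds \<open>A * B\<close> by each of the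
  first two and gives the upper bound.\<close>

lemma Var_of_bool_diff:
  assumes "finite (set_pmf p)" "i \<noteq> j"
  defines "A \<equiv> pmf p i" and "B \<equiv> pmf p j"
  shows "A * (1 - A) \<le> Var p (\<lambda>z. of_bool (z = i) - of_bool (z = j))"
    and "Var p (\<lambda>z. of_bool (z = i) - of_bool (z = j)) \<le> 2 * (A * (1 - A) + B * (1 - B))"
proof -
  have "E p (\<lambda>z. (of_bool (z = i) - of_bool (z = j))^2) = E p (\<lambda>z. of_bool (z = i) + of_bool (z = j))"
    using assms(2) by (intro E_cong) auto
  also have "\<dots> = A + B" unfolding A_def B_def by (simp add: E_add[OF assms(1)] E_of_bool)
  finally have V: "Var p (\<lambda>z. of_bool (z = i) - of_bool (z = j)) = A + B - (A - B)^2"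
    by (simp add: Var_eq[OF assms(1)] E_diff[OF assms(1)] E_of_bool A_def B_def)
  have AB: "A \<ge> 0" "B \<ge> 0" by (auto simp: A_def B_def)
  have "A + B = measure_pmf.prob p {i, j}"
    using assms(2) by (simp add: A_def B_def measure_measure_pmf_finite)
  then have sum1: "A + B \<le> 1" by simp
  have V2: "A + B - (A - B)^2 = A * (1 - A) + B * (1 - B) + 2 * (A * B)"
    by (simp add: power2_eq_square algebra_simps)
  have "B * (1 - B) \<ge> 0" "A * B \<ge> 0" using AB sum1 by auto
  then show "A * (1 - A) \<le> Var p (\<lambda>z. of_bool (z = i) - of_bool (z = j))" unfolding V V2 by simp
  have "A * B \<le> A * (1 - A)" "B * A \<le> B * (1 - B)" using AB sum1 by (auto intro!: mult_left_mono)
  then show "Var p (\<lambda>z. of_bool (z = i) - of_bool (z = j)) \<le> 2 * (A * (1 - A) + B * (1 - B))"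
    unfolding V V2 by (simp add: mult.commute)
qed

section \<open>Exponential, second and fourth moments of independent sums\<close>

lemma exp_bound_abs1:
  fixes x :: real
  assumes "\<bar>x\<bar> \<le> 1"
  shows "exp x \<le> 1 + x + x^2"
proof (cases "x \<ge> 0")
  case True
  then show ?thesis using assms exp_bound[of x] by simp
next
  case False
  define y where "y = -x"
  have y: "0 \<le> y" "y \<le> 1" using False assms by (auto simp: y_def)
  \<comment> \<open>The product is \<open>1 + y^3\<close>.\<close>
  have "1 \<le> (1 - y + y^2) * (1 + y)"
    using y by (simp add: algebra_simps power2_eq_square)
  also have "\<dots> \<le> (1 - y + y^2) * exp y"
    using y by (intro mult_left_mono) (auto simp: power2_eq_square)
  finally have "exp (-y) \<le> 1 - y + y^2"
    by (simp add: exp_minus field_simps)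
  then show ?thesis by (simp add: y_def)
qed

text \<open>After centring, the linear term of \<open>1 + y + y^2\<close> has expectation zero, so
  the variance and not the range enters the exponent.\<close>

lemma E_exp_bernstein:
  assumes fin: "finite (set_pmf p)" and b: "\<And>z. z \<in> set_pmf p \<Longrightarrow> \<bar>f z - E p f\<bar> \<le> 1"
  shows "E p (\<lambda>z. exp (f z)) \<le> exp (E p f + Var p f)"
proof -
  define m where "m = E p f"
  have "E p (\<lambda>z. exp (f z)) = exp m * E p (\<lambda>z. exp (f z - m))"
    by (simp flip: exp_add integral_mult_right_zero)
  also have "E p (\<lambda>z. exp (f z - m)) \<le> E p (\<lambda>z. 1 + (f z - m) + (f z - m)^2)"
    using fin b by (intro E_mono exp_bound_abs1) (auto simp: m_def)
  also have "\<dots> = 1 + Var p f"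
    using fin by (simp add: E_add E_diff Var_def m_def)
  also have "\<dots> \<le> exp (Var p f)" by (rule exp_ge_add_one_self)
  finally show ?thesis by (simp add: exp_add m_def)
qed

lemma E_Pi_exp_bernstein:
  assumes A: "finite A" and fin: "\<And>v. v \<in> A \<Longrightarrow> finite (set_pmf (p v))"
    and b: "\<And>v z. v \<in> A \<Longrightarrow> z \<in> set_pmf (p v) \<Longrightarrow> \<bar>f v z - E (p v) (f v)\<bar> \<le> 1"
  shows "E (Pi_pmf A d p) (\<lambda>y. exp (\<Sum>v\<in>A. f v (y v)))
     \<le> exp ((\<Sum>v\<in>A. E (p v) (f v)) + (\<Sum>v\<in>A. Var (p v) (f v)))"
proof -
  have "E (Pi_pmf A d p) (\<lambda>y. exp (\<Sum>v\<in>A. f v (y v))) = (\<Prod>v\<in>A. E (p v) (\<lambda>z. exp (f v z)))"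
    using A by (simp add: exp_sum, subst expectation_prod_Pi_pmf) (auto simp: fin integrable_measure_pmf_finite)
  also have "\<dots> \<le> (\<Prod>v\<in>A. exp (E (p v) (f v) + Var (p v) (f v)))"
    using fin b by (intro prod_mono) (auto intro!: E_exp_bernstein)
  finally show ?thesis using A by (simp add: exp_sum[symmetric] sum.distrib)
qed

text \<open>Coordinates are added one at a time. Terms linear in one of the two independent parts
  vanish, \<open>6 * t * s\<close> is the cross term of \<open>3 * (t + s)^2\<close>, and the range
  2 gives \<open>f^4 \<le> 4 * f^2\<close>. The range 2 fits a difference of two centred
  indicators.\<close>

lemma E_Pi_centred_moments:
  assumes "finite A" "\<And>v. v \<in> A \<Longrightarrow> finite (set_pmf (p v))"
    and "\<And>v. v \<in> A \<Longrightarrow> E (p v) (f v) = 0"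
    and "\<And>v z. v \<in> A \<Longrightarrow> z \<in> set_pmf (p v) \<Longrightarrow> \<bar>f v z\<bar> \<le> 2"
  shows "E (Pi_pmf A d p) (\<lambda>y. \<Sum>v\<in>A. f v (y v)) = 0
    \<and> E (Pi_pmf A d p) (\<lambda>y. (\<Sum>v\<in>A. f v (y v))^2) = (\<Sum>v\<in>A. E (p v) (\<lambda>z. (f v z)^2))
    \<and> E (Pi_pmf A d p) (\<lambda>y. (\<Sum>v\<in>A. f v (y v))^4)
        \<le> 4 * (\<Sum>v\<in>A. E (p v) (\<lambda>z. (f v z)^2)) + 3 * (\<Sum>v\<in>A. E (p v) (\<lambda>z. (f v z)^2))^2"
  using assms
proof (induction A rule: finite_induct)
  case empty
  show ?case by simp
next
  case (insert x A)
  let ?P = "Pi_pmf A d p"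
  define S where "S = (\<lambda>y. \<Sum>v\<in>A. f v (y v))"
  define s where "s = (\<Sum>v\<in>A. E (p v) (\<lambda>z. (f v z)^2))"
  define t where "t = E (p x) (\<lambda>z. (f x z)^2)"
  have finP: "finite (set_pmf ?P)" and finx: "finite (set_pmf (p x))"
    using insert by (auto intro: finite_set_Pi_pmf)
  have IH: "E ?P S = 0" "E ?P (\<lambda>y. (S y)^2) = s" "E ?P (\<lambda>y. (S y)^4) \<le> 4 * s + 3 * s^2"
    using insert unfolding S_def s_def by auto
  have s0: "0 \<le> s" unfolding s_def by (intro sum_nonneg) auto
  have t0: "0 \<le> t" unfolding t_def by simp
  have Su: "(\<Sum>v\<in>insert x A. f v ((y(x := a)) v)) = f x a + S y" for y a
    using insert by (auto simp: S_def intro!: sum.cong)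
  have red: "E (Pi_pmf (insert x A) d p) (\<lambda>y. (\<Sum>v\<in>insert x A. f v (y v))^k)
      = E (p x) (\<lambda>a. E ?P (\<lambda>y. (f x a + S y)^k))" for k
    by (subst E_Pi_insert) (use insert Su in auto)
  have fx: "E (p x) (f x) = 0" using insert by simp
  have c1: "E (p x) (\<lambda>a. E ?P (\<lambda>y. (f x a + S y)^1)) = 0"
    using finP finx fx IH by (simp add: E_add)
  have "E ?P (\<lambda>y. (f x a + S y)^2) = (f x a)^2 + s" for a
  proof -
    have "E ?P (\<lambda>y. (f x a + S y)^2) = E ?P (\<lambda>y. (f x a)^2 + 2 * f x a * S y + (S y)^2)"
      by (simp add: power2_eq_square algebra_simps)
    also have "\<dots> = (f x a)^2 + s" using finP IH by (simp add: E_add)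
    finally show ?thesis .
  qed
  then have c2: "E (p x) (\<lambda>a. E ?P (\<lambda>y. (f x a + S y)^2)) = t + s"
    using finx by (simp add: E_add t_def)
  have "E ?P (\<lambda>y. (f x a + S y)^4) = (f x a)^4 + 6 * (f x a)^2 * s
          + 4 * f x a * E ?P (\<lambda>y. (S y)^3) + E ?P (\<lambda>y. (S y)^4)" for a
  proof -
    have "E ?P (\<lambda>y. (f x a + S y)^4) = E ?P (\<lambda>y. (f x a)^4 + 4 * (f x a)^3 * S y
        + 6 * (f x a)^2 * (S y)^2 + 4 * f x a * (S y)^3 + (S y)^4)"
      by (rule E_cong) (simp add: power2_eq_square power3_eq_cube power4_eq_xxxx algebra_simps)
    also have "\<dots> = (f x a)^4 + 6 * (f x a)^2 * s
          + 4 * f x a * E ?P (\<lambda>y. (S y)^3) + E ?P (\<lambda>y. (S y)^4)" using finP IH by (simp add: E_add)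
    finally show ?thesis .
  qed
  \<comment> \<open>The third moment of \<open>S\<close> need not be known, because its factor
    \<open>f x a\<close> has mean zero.\<close>
  then have c4: "E (p x) (\<lambda>a. E ?P (\<lambda>y. (f x a + S y)^4))
     = E (p x) (\<lambda>a. (f x a)^4) + 6 * t * s + E ?P (\<lambda>y. (S y)^4)"
    using finx fx by (simp add: E_add t_def)
  have "E (p x) (\<lambda>a. (f x a)^4) \<le> E (p x) (\<lambda>a. 4 * (f x a)^2)"
  proof (rule E_mono[OF finx])
    fix a assume "a \<in> set_pmf (p x)"
    then have "\<bar>f x a\<bar> \<le> 2" using insert by auto
    then have "(f x a)^2 \<le> 2^2" by (rule power2_le_iff_abs_le[THEN iffD2, rotated]) simp
    then have "(f x a)^2 * (f x a)^2 \<le> 4 * (f x a)^2" by (intro mult_right_mono) auto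
    then show "(f x a)^4 \<le> 4 * (f x a)^2" by (simp add: power4_eq_xxxx power2_eq_square mult.assoc)
  qed
  then have "E (p x) (\<lambda>a. (f x a)^4) \<le> 4 * t" by (simp add: t_def)
  moreover have "4 * (t + s) + 3 * (t + s)^2 = 4 * t + 4 * s + 6 * t * s + 3 * s^2 + 3 * t^2"
    by (simp add: power2_eq_square algebra_simps)
  ultimately have c4': "E (p x) (\<lambda>a. E ?P (\<lambda>y. (f x a + S y)^4)) \<le> 4 * (t + s) + 3 * (t + s)^2"
    unfolding c4 using IH(3) zero_le_power2[of t] by linarith
  have ts: "(\<Sum>v\<in>insert x A. E (p v) (\<lambda>z. (f v z)^2)) = t + s"
    using insert by (simp add: s_def t_def)
  show ?case
    unfolding ts using red[of 1] red[of 2] red[of 4] c1 c2 c4' by simp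
qed

lemma E_Pi_moments:
  fixes f :: "'a \<Rightarrow> 'b \<Rightarrow> real"
  assumes A: "finite A" and fin: "\<And>v. v \<in> A \<Longrightarrow> finite (set_pmf (p v))"
    and b: "\<And>v z. v \<in> A \<Longrightarrow> z \<in> set_pmf (p v) \<Longrightarrow> \<bar>f v z - E (p v) (f v)\<bar> \<le> 2"
  defines "X \<equiv> (\<lambda>y. \<Sum>v\<in>A. f v (y v))"
    and "M \<equiv> \<Sum>v\<in>A. E (p v) (f v)" and "s \<equiv> \<Sum>v\<in>A. Var (p v) (f v)"
  shows "E (Pi_pmf A d p) X = M"
    and "E (Pi_pmf A d p) (\<lambda>y. (X y - M)^2) = s"
    and "E (Pi_pmf A d p) (\<lambda>y. (X y - M)^4) \<le> 4 * s + 3 * s^2"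
proof -
  have "X y - M = (\<Sum>v\<in>A. f v (y v) - E (p v) (f v))" for y
    by (simp add: X_def M_def sum_subtractf)
  moreover note E_Pi_centred_moments[of A p "\<lambda>v z. f v z - E (p v) (f v)" d, OF A fin _ b]
  ultimately show "E (Pi_pmf A d p) (\<lambda>y. (X y - M)^2) = s"
    "E (Pi_pmf A d p) (\<lambda>y. (X y - M)^4) \<le> 4 * s + 3 * s^2"
    using fin by (simp_all add: E_diff s_def Var_def)
  show "E (Pi_pmf A d p) X = M"
    unfolding X_def M_def using A fin by (rule E_Pi_sum)
qed

section \<open>Hitting times of Markov chains\<close>

text \<open>The probability that \<open>P\<close> fails at all times from 0 to \<open>t\<close>.
  Conditioning on the first round, rather than on whole trajectories, lets bounds be proved by
  induction for all starting states at once.\<close>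

primrec nohit :: "('a \<Rightarrow> bool) \<Rightarrow> ('a \<Rightarrow> 'a pmf) \<Rightarrow> nat \<Rightarrow> 'a \<Rightarrow> real" where
  "nohit P S 0 c = (if P c then 0 else 1)"
| "nohit P S (Suc t) c = (if P c then 0 else E (S c) (nohit P S t))"

context
  fixes I :: "'a \<Rightarrow> bool" and S :: "'a \<Rightarrow> 'a pmf"
  assumes fin: "\<And>c. I c \<Longrightarrow> finite (set_pmf (S c))"
    and inv: "\<And>c c'. I c \<Longrightarrow> c' \<in> set_pmf (S c) \<Longrightarrow> I c'"
begin

lemma nohit_le_1: "I c \<Longrightarrow> nohit P S t c \<le> 1"
proof (induction t arbitrary: c)
  case (Suc t)
  then have "E (S c) (nohit P S t) \<le> 1" by (intro E_const_le fin) (auto dest: inv)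
  then show ?case by simp
qed simp

lemma nohit_antimono:
  assumes "I c" "s \<le> t"
  shows "nohit P S t c \<le> nohit P S s c"
proof -
  have "nohit P S (Suc t) c \<le> nohit P S t c" if "I c" for t c
    using that
  proof (induction t arbitrary: c)
    case 0
    then show ?case using nohit_le_1[of c P "Suc 0"] by (cases "P c") simp_all
  next
    case (Suc t)
    then have "E (S c) (nohit P S (Suc t)) \<le> E (S c) (nohit P S t)"
      by (intro E_mono fin Suc.IH) (auto dest: inv)
    then show ?case by (cases "P c") simp_all
  qed
  from lift_Suc_antimono_le[of "\<lambda>t. nohit P S t c", OF this[OF assms(1)] assms(2)] show ?thesis .
qed

text \<open>A strong Markov property with a union bound: either \<open>A\<close> is not met within
  \<open>s\<close> rounds, or the chain restarts in \<open>A\<close> with at least \<open>t\<close>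
  rounds left.\<close>

lemma nohit_restart:
  assumes PA: "\<And>c. P c \<Longrightarrow> A c" and h: "\<And>c. I c \<Longrightarrow> A c \<Longrightarrow> nohit P S t c \<le> h" and "0 \<le> h"
    and "I c"
  shows "nohit P S (s + t) c \<le> nohit A S s c + h"
  using \<open>I c\<close>
proof (induction s arbitrary: c)
  case 0
  then show ?case using nohit_le_1[of c P t] h[of c] \<open>0 \<le> h\<close> by auto
next
  case (Suc s)
  show ?case
  proof (cases "A c")
    case True
    have "nohit P S (Suc s + t) c \<le> nohit P S t c"
      by (rule nohit_antimono[OF Suc.prems]) simp
    also have "\<dots> \<le> h" by (rule h[OF Suc.prems True])
    finally show ?thesis using True by simp
  next
    case False
    then have "nohit P S (Suc s + t) c = E (S c) (nohit P S (s + t))" using PA by auto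
    also have "\<dots> \<le> E (S c) (\<lambda>c. nohit A S s c + h)"
      using Suc by (intro E_mono fin) (auto dest: inv)
    also have "\<dots> = E (S c) (nohit A S s) + h"
      by (simp add: E_add fin[OF Suc.prems])
    finally show ?thesis using False by simp
  qed
qed

text \<open>\<open>A\<close> is the target and \<open>B\<close> the region where \<open>W\<close>
  contracts. A chain that has not met \<open>A\<close> either has left \<open>B\<close>, which
  \<open>G\<close> pays for by being at least 1 there, or is still in \<open>B\<close> with
  \<open>W \<ge> 1\<close>, which the contraction makes unlikely.\<close>

lemma nohit_potential:
  assumes G: "\<And>c. I c \<Longrightarrow> 0 \<le> G c" "\<And>c. I c \<Longrightarrow> \<not> A c \<Longrightarrow> \<not> B c \<Longrightarrow> 1 \<le> G c"
      "\<And>c. I c \<Longrightarrow> \<not> A c \<Longrightarrow> B c \<Longrightarrow> E (S c) G \<le> r * G c"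
    and W: "\<And>c. I c \<Longrightarrow> 0 \<le> W c" "\<And>c. I c \<Longrightarrow> \<not> A c \<Longrightarrow> 1 \<le> W c"
      "\<And>c. I c \<Longrightarrow> \<not> A c \<Longrightarrow> B c \<Longrightarrow> E (S c) W \<le> q * W c"
    and "1 \<le> r" "0 \<le> q" "I c"
  shows "nohit A S t c \<le> r^t * G c + q^t * W c"
  using \<open>I c\<close>
proof (induction t arbitrary: c)
  case 0
  then show ?case using G(1)[of c] W(1,2)[of c] by auto
next
  case (Suc t)
  consider "A c" | "\<not> A c" "\<not> B c" | "\<not> A c" "B c" by blast
  then show ?case
  proof cases
    case 1
    then show ?thesis
      using G(1)[OF Suc.prems] W(1)[OF Suc.prems] \<open>1 \<le> r\<close> \<open>0 \<le> q\<close> by simp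
  next
    case 2
    have "nohit A S (Suc t) c \<le> 1 * 1" using nohit_le_1[OF Suc(2)] by (simp del: nohit.simps)
    also have "\<dots> \<le> r ^ Suc t * G c"
      using G(2)[OF Suc.prems] 2 \<open>1 \<le> r\<close> by (intro mult_mono one_le_power) auto
    also have "\<dots> \<le> r ^ Suc t * G c + q ^ Suc t * W c"
      using W(1)[OF Suc.prems] \<open>0 \<le> q\<close> by simp
    finally show ?thesis .
  next
    case 3
    then have "nohit A S (Suc t) c = E (S c) (nohit A S t)" by simp
    also have "\<dots> \<le> E (S c) (\<lambda>c. r^t * G c + q^t * W c)"
      using Suc by (intro E_mono fin) (auto dest: inv)
    also have "\<dots> = r^t * E (S c) G + q^t * E (S c) W"
      by (simp add: E_add fin[OF Suc.prems])
    also have "\<dots> \<le> r^t * (r * G c) + q^t * (q * W c)"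
      using G(3)[OF Suc.prems 3] W(3)[OF Suc.prems 3] \<open>1 \<le> r\<close> \<open>0 \<le> q\<close>
      by (intro add_mono mult_left_mono) auto
    finally show ?thesis by (simp add: mult_ac)
  qed
qed

end

section \<open>From trajectories to \<open>nohit\<close>\<close>

lemma length_trajectory: "xs \<in> set_pmf (trajectory n rule c0 t) \<Longrightarrow> length xs = Suc t"
  by (induction t arbitrary: xs) auto

lemma finite_set_trajectory:
  assumes "\<And>c. finite (set_pmf (sync_step n rule c))"
  shows "finite (set_pmf (trajectory n rule c0 t))"
  using assms by (induction t) auto

text \<open>Appending a round to the trajectory moves one round from \<open>s\<close> to \<open>t\<close>.\<close>

lemma trajectory_nohit:
  fixes P :: "config \<Rightarrow> bool"
  assumes fin: "\<And>c. finite (set_pmf (sync_step n rule c))"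
  shows "E (trajectory n rule c0 t) (\<lambda>xs. if \<exists>c\<in>set (butlast xs). P c then 0
            else nohit P (sync_step n rule) s (last xs))
         = nohit P (sync_step n rule) (t + s) c0"
proof (induction t arbitrary: s)
  case 0
  show ?case by simp
next
  case (Suc t)
  let ?N = "nohit P (sync_step n rule)"
  let ?J = "\<lambda>s xs. if \<exists>c\<in>set (butlast xs). P c then 0 else ?N s (last xs)"
  have "E (trajectory n rule c0 (Suc t)) (?J s)
     = E (trajectory n rule c0 t) (\<lambda>xs. E (sync_step n rule (last xs)) (\<lambda>c. ?J s (xs @ [c])))"
    by (simp, subst E_bind) (use fin finite_set_trajectory in auto)
  also have "\<dots> = E (trajectory n rule c0 t) (?J (Suc s))"
  proof (rule E_cong)
    fix xs assume "xs \<in> set_pmf (trajectory n rule c0 t)"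
    then have "xs \<noteq> []" using length_trajectory by fastforce
    then have "set xs = insert (last xs) (set (butlast xs))"
      by (metis Un_insert_right append_butlast_last_id list.simps(15) set_append sup_bot.right_neutral list.set(1))
    then show "E (sync_step n rule (last xs)) (\<lambda>c. ?J s (xs @ [c])) = ?J (Suc s) xs" by auto
  qed
  finally show ?case using Suc by simp
qed

lemma prob_cons_by_eq:
  assumes fin: "\<And>c. finite (set_pmf (sync_step n rule c))"
  shows "prob_cons_by n k rule c0 T = 1 - nohit (is_consensus n k) (sync_step n rule) T c0"
proof -
  let ?A = "{xs. \<exists>t\<le>T. is_consensus n k (xs ! t)}"
  let ?P = "is_consensus n k"
  \<comment> \<open>With no rounds left \<open>nohit\<close> still tests the last configuration, so
    all times from 0 to \<open>T\<close> are covered.\<close>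
  have "nohit ?P (sync_step n rule) T c0 = E (trajectory n rule c0 T) (\<lambda>xs. if \<exists>c\<in>set (butlast xs). ?P c then 0
            else nohit ?P (sync_step n rule) 0 (last xs))"
    using trajectory_nohit[OF fin, of c0 T ?P 0] by simp
  also have "\<dots> = E (trajectory n rule c0 T) (\<lambda>xs. 1 - indicator ?A xs)"
  proof (rule E_cong)
    fix xs assume "xs \<in> set_pmf (trajectory n rule c0 T)"
    then have len: "length xs = Suc T" by (rule length_trajectory)
    then have "xs \<noteq> []" by auto
    then have "(\<exists>c\<in>set (butlast xs). ?P c) \<or> ?P (last xs) \<longleftrightarrow> (\<exists>c\<in>set xs. ?P c)"
      by (metis Un_iff append_butlast_last_id last_in_set list.set_intros(1) set_ConsD set_append in_set_butlastD empty_iff list.set(1))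
    also have "\<dots> \<longleftrightarrow> xs \<in> ?A"
      using len by (auto simp: in_set_conv_nth less_Suc_eq_le) (metis less_Suc_eq_le nth_mem)
    finally show "(if \<exists>c\<in>set (butlast xs). ?P c then 0 else nohit ?P (sync_step n rule) 0 (last xs))
        = 1 - indicator ?A xs" by (auto simp: indicator_def)
  qed
  also have "\<dots> = 1 - measure_pmf.prob (trajectory n rule c0 T) ?A"
    by (subst E_diff) (auto intro: finite_set_trajectory fin)
  finally show ?thesis unfolding prob_cons_by_def by simp
qed

section \<open>Configurations\<close>

definition valid :: "nat \<Rightarrow> nat \<Rightarrow> config \<Rightarrow> bool" where
  "valid n k c \<longleftrightarrow> (\<forall>v<n. c v \<in> {1..k})"

lemma alpha_eq_sum: "alpha n c i = (\<Sum>v<n. of_bool (c v = i)) / real n"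
  by (simp add: alpha_def sum.If_cases of_bool_def Int_def)

lemma alpha_nonneg: "0 \<le> alpha n c i"
  by (simp add: alpha_def)

lemma alpha_le_1: "alpha n c i \<le> 1"
proof -
  have "card {v\<in>{..<n}. c v = i} \<le> card {..<n}" by (intro card_mono) auto
  then show ?thesis by (simp add: alpha_def divide_le_eq)
qed

text \<open>Exchanges averages over opinions for averages over vertices. The samples and the
  independent choices live on vertices, the potentials on opinions.\<close>

lemma sum_alpha_mult:
  assumes "valid n k c"
  shows "(\<Sum>i\<in>{1..k}. alpha n c i * h i) = (\<Sum>v<n. h (c v)) / real n"
proof -
  have "(\<Sum>i\<in>{1..k}. alpha n c i * h i) = (\<Sum>i\<in>{1..k}. \<Sum>v<n. of_bool (c v = i) * h i) / real n"
    by (simp add: alpha_eq_sum sum_divide_distrib sum_distrib_right)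
  also have "(\<Sum>i\<in>{1..k}. \<Sum>v<n. of_bool (c v = i) * h i) = (\<Sum>v<n. \<Sum>i\<in>{1..k}. of_bool (c v = i) * h i)"
    by (rule sum.swap)
  also have "\<dots> = (\<Sum>v<n. h (c v))"
  proof (rule sum.cong)
    fix v assume "v \<in> {..<n}"
    then have cv: "c v \<in> {1..k}" using assms by (auto simp: valid_def)
    have "(\<Sum>i\<in>{1..k}. of_bool (c v = i) * h i) = (\<Sum>i\<in>{1..k}. if i = c v then h (c v) else 0)"
      by (rule sum.cong) auto
    then show "(\<Sum>i\<in>{1..k}. of_bool (c v = i) * h i) = h (c v)" using cv by simp
  qed simp
  finally show ?thesis .
qed

lemma sum_alpha:
  assumes "valid n k c" "n > 0"
  shows "(\<Sum>i\<in>{1..k}. alpha n c i) = 1"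
  using sum_alpha_mult[OF assms(1), of "\<lambda>_. 1"] assms(2) by simp

lemma gamma_nonneg: "0 \<le> gamma n k c"
  by (simp add: gamma_def sum_nonneg)

lemma gamma_le_1:
  assumes "valid n k c" "n > 0"
  shows "gamma n k c \<le> 1"
proof -
  have "gamma n k c \<le> (\<Sum>i\<in>{1..k}. alpha n c i)"
    unfolding gamma_def power2_eq_square
    by (intro sum_mono mult_left_le alpha_nonneg alpha_le_1)
  then show ?thesis using sum_alpha[OF assms] by simp
qed

text \<open>Under the weights \<open>alpha n c i\<close> the function \<open>alpha n c\<close> has
  mean \<open>gamma n k c\<close>, and its variance is nonnegative.\<close>

lemma gamma_sq_le_sum_cubes:
  assumes "valid n k c" "n > 0"
  shows "(gamma n k c)^2 \<le> (\<Sum>i\<in>{1..k}. (alpha n c i)^3)"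
proof -
  let ?a = "alpha n c" and ?g = "gamma n k c"
  have "0 \<le> (\<Sum>i\<in>{1..k}. ?a i * (?a i - ?g)^2)"
    by (intro sum_nonneg mult_nonneg_nonneg alpha_nonneg) auto
  also have "\<dots> = (\<Sum>i\<in>{1..k}. (?a i)^3 - 2 * ?g * (?a i)^2 + ?g^2 * ?a i)"
    by (intro sum.cong) (auto simp: power2_eq_square power3_eq_cube algebra_simps)
  also have "\<dots> = (\<Sum>i\<in>{1..k}. (?a i)^3) - 2 * ?g * ?g + ?g^2 * 1"
    by (subst sum_alpha[OF assms, symmetric])
       (simp add: sum.distrib sum_subtractf sum_distrib_left gamma_def del: One_nat_def)
  finally show ?thesis by (simp add: power2_eq_square)
qed

section \<open>Expected reciprocals under drift and noise\<close>

lemma inverse_taylor: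
  fixes u z :: real
  assumes "u \<noteq> 0" "u + z \<noteq> 0"
  shows "1 / (u + z) = 1 / u - z / u^2 + z^2 / (u^2 * (u + z))"
proof -
  define y where "y = u + z"
  have z: "z = y - u" and y: "y \<noteq> 0" using assms by (auto simp: y_def)
  show ?thesis unfolding y_def[symmetric] using assms(1) y
    by (simp add: z power2_eq_square divide_simps) (simp add: algebra_simps)
qed

text \<open>The potential \<open>1 / (k + X\<^sup>2)\<close> contracts both for small and for large \<open>X\<close>: near \<open>0\<close> because of the
  variance, and away from \<open>0\<close> because of the drift \<open>d \<mapsto> d * (1 + r)\<close>.\<close>

lemma E_inverse_square_le:
  fixes X :: "'a \<Rightarrow> real"
  assumes fin: "finite (set_pmf P)" and k: "k > 0"
    and m1: "E P X = M" and m2: "E P (\<lambda>y. (X y - M)^2) = s"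
    and m4: "E P (\<lambda>y. (X y - M)^4) \<le> 4 * s + 3 * s^2"
  shows "E P (\<lambda>y. 1 / (k + (X y)^2))
     \<le> 1 / (k + M^2) * (1 - s / (k + M^2) + (8 * M^2 * s + 8 * s + 6 * s^2) / ((k + M^2) * k))"
proof -
  define u where "u = k + M^2"
  have u: "u > 0" "u \<ge> k" using k by (auto simp: u_def add_pos_nonneg)
  \<comment> \<open>The denominator of the Taylor remainder is at least \<open>k\<close>, so the
    bound is a polynomial of degree four in \<open>x - M\<close>.\<close>
  have pw: "1 / (k + x^2) \<le> 1/u - (2 * M / u^2) * (x - M) - (1/u^2) * (x - M)^2
      + (8 * M^2 / (u^2 * k)) * (x-M)^2 + (2 / (u^2*k)) * (x-M)^4" for x
  proof -
    define z where "z = x - M"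
    define e where "e = 2 * M * z + z^2"
    have ke: "k + x^2 = u + e" by (simp add: u_def e_def z_def power2_eq_square algebra_simps)
    have pos: "u + e \<ge> k" unfolding ke[symmetric] by simp
    have "1 / (u + e) = 1/u - e/u^2 + e^2 / (u^2 * (u + e))"
      using u pos k by (intro inverse_taylor) auto
    also have "e^2 / (u^2 * (u + e)) \<le> e^2 / (u^2 * k)"
      using u pos k by (intro divide_left_mono mult_left_mono mult_pos_pos) auto
    also have "e^2 \<le> 8 * M^2 * z^2 + 2 * z^4"
    proof -
      have "0 \<le> (2 * M * z - z^2)^2" by simp
      then show ?thesis by (simp add: e_def power2_eq_square power4_eq_xxxx algebra_simps)
    qed
    finally have "1 / (u + e) \<le> 1/u - e/u^2 + (8 * M^2 * z^2 + 2 * z^4) / (u^2 * k)"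
      using u k by (simp add: divide_right_mono)
    also have "\<dots> = 1/u - (2 * M / u^2) * z - (1/u^2) * z^2 + (8 * M^2 / (u^2 * k)) * z^2 + (2 / (u^2*k)) * z^4"
      by (simp add: e_def add_divide_distrib diff_divide_distrib)
    finally show ?thesis unfolding ke z_def .
  qed
  have "E P (\<lambda>y. 1 / (k + (X y)^2)) \<le> E P (\<lambda>y. 1/u - (2 * M / u^2) * (X y - M) - (1/u^2) * (X y - M)^2
      + (8 * M^2 / (u^2 * k)) * (X y-M)^2 + (2 / (u^2*k)) * (X y-M)^4)"
    by (intro E_mono fin pw)
  also have "\<dots> = 1/u - (1/u^2) * s + (8 * M^2 / (u^2 * k)) * s + (2 / (u^2*k)) * E P (\<lambda>y. (X y-M)^4)"
    using fin m1 m2 by (simp add: E_add E_diff)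
  also have "\<dots> \<le> 1/u - (1/u^2) * s + (8 * M^2 / (u^2 * k)) * s + (2 / (u^2*k)) * (4 * s + 3 * s^2)"
    using m4 u k by (intro add_left_mono mult_left_mono) auto
  also have "\<dots> = 1/u * (1 - s / u + (8 * M^2 * s + 8 * s + 6 * s^2) / (u * k))"
    using u k by (simp add: field_simps power2_eq_square)
  finally show ?thesis unfolding u_def .
qed

text \<open>If \<open>M^2 \<le> k / 32\<close>, the variance gain \<open>s / u\<close> beats the
  remainder and is of order \<open>g\<close>, as \<open>u\<close> is comparable to \<open>k\<close>.
  Otherwise \<open>u\<close> is comparable to \<open>d^2\<close> and the drift gains a relative
  \<open>g / 330\<close>; the factor \<open>10^6\<close> in \<open>k\<close> keeps the noise
  \<open>576 * g / 10^6\<close> below that.\<close>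

lemma inverse_square_contraction:
  fixes d r g s h :: real
  assumes g: "0 < g" "g \<le> 1" and r: "g / 5 \<le> r" "r \<le> 1" and h: "h \<ge> 1"
    and s: "h * g / 400 \<le> s" "s \<le> 72 * h * g"
  defines "k \<equiv> 10^6 * h" and "M \<equiv> d * (1 + r)"
  shows "1 / (k + M^2) * (1 - s / (k + M^2) + (8 * M^2 * s + 8 * s + 6 * s^2) / ((k + M^2) * k))
     \<le> (1 - g / 10^10) * (1 / (k + d^2))"
proof -
  define u where "u = k + M^2"
  have k: "k > 0" using h by (simp add: k_def)
  have u: "u > 0" "u \<ge> k" using k by (auto simp: u_def add_pos_nonneg)
  have r0: "r > 0" using r g by linarith
  have hg: "0 < h * g" using h g by simp
  have s0: "s > 0" using s(1) hg by linarith
  have "1 \<le> 1 + r" using r0 by simp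
  then have "1 \<le> (1 + r)^2" by (rule one_le_power)
  then have "d^2 * 1 \<le> d^2 * (1 + r)^2" by (intro mult_left_mono) auto
  then have dM: "d^2 \<le> M^2" by (simp add: M_def power_mult_distrib)
  have sk: "s / k \<le> 72 * g / 10^6" "g / (400 * 10^6) \<le> s / k"
    using s h k by (auto simp: k_def field_simps)
  have "s \<le> 72 * h" using s g h mult_left_mono[of g 1 h] by linarith
  then have a: "(8 + 6 * s) / k \<le> 1/4"
    using h by (simp add: k_def field_simps)
  have "(8 * s + 6 * s^2) / (u * k) = (s / u) * ((8 + 6 * s) / k)"
    using u k by (simp add: field_simps power2_eq_square)
  also have "\<dots> \<le> (s / u) * (1/4)" using a s0 u by (intro mult_left_mono) auto
  finally have b: "1 - s / u + (8 * M^2 * s + 8 * s + 6 * s^2) / (u * k) \<le> 1 - 3/4 * (s/u) + 8 * M^2 * s / (u * k)"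
    by (simp add: add_divide_distrib)
  have kd: "k + d^2 > 0" using k by (simp add: add_pos_nonneg)
  show ?thesis
  proof (cases "M^2 \<le> k / 32")
    case True
    have "8 * M^2 * s / (u * k) = (s/u) * (8 * M^2 / k)" using u k by (simp add: field_simps)
    also have "\<dots> \<le> (s/u) * (1/4)" using True k s0 u by (intro mult_left_mono) (auto simp: field_simps)
    finally have e: "1 - s / u + (8 * M^2 * s + 8 * s + 6 * s^2) / (u * k) \<le> 1 - 1/2 * (s/u)"
      using b by simp
    have "s / (2 * k) \<le> s / u"
      using True s0 k u by (intro divide_left_mono) (auto simp: u_def)
    then have "(s / k) / 2 \<le> s / u" by simp
    then have c: "1 - s / u + (8 * M^2 * s + 8 * s + 6 * s^2) / (u * k) \<le> 1 - g / 10^10"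
      using e sk(2) g by simp
    have "1 / u * (1 - s / u + (8 * M^2 * s + 8 * s + 6 * s^2) / (u * k)) \<le> 1 / u * (1 - g / 10^10)"
      using c u by (intro mult_left_mono) auto
    also have "\<dots> \<le> 1 / (k + d^2) * (1 - g / 10^10)"
      using dM kd g u by (intro mult_right_mono divide_left_mono) (auto simp: u_def)
    finally show ?thesis by (simp add: u_def mult.commute)
  next
    case False
    have "8 * M^2 * s / (u * k) = 8 * (s / k) * (M^2 / u)" using u k by (simp add: field_simps)
    also have "\<dots> \<le> 8 * (s / k) * 1"
      using s0 k u by (intro mult_left_mono) (auto simp: u_def)
    finally have c: "1 - s / u + (8 * M^2 * s + 8 * s + 6 * s^2) / (u * k) \<le> 1 + 576 * g / 10^6"
      using b sk(1) divide_pos_pos[OF s0 u(1)] by linarith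
    have "d \<noteq> 0" using False k by (auto simp: M_def)
    then have d2: "d^2 > 0" by simp
    have "u \<le> 33 * M^2" using False by (simp add: u_def)
    also have "\<dots> = 33 * (1 + r)^2 * d^2" by (simp add: M_def power_mult_distrib)
    also have "(1 + r)^2 \<le> 2^2" using r r0 by (intro power_mono) auto
    finally have u132: "u \<le> 132 * d^2" using d2 by simp
    have "(g / 330) * u \<le> (g/330) * (132 * d^2)" using u132 g by (intro mult_left_mono) auto
    also have "\<dots> = 2 * (g / 5) * d^2" by simp
    also have "\<dots> \<le> 2 * r * d^2" using r d2 by (intro mult_right_mono) auto
    also have "\<dots> \<le> (2 * r + r^2) * d^2" by (intro mult_right_mono) auto
    also have "\<dots> = u - (k + d^2)" by (simp add: u_def M_def power2_eq_square algebra_simps)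
    finally have "k + d^2 \<le> (1 - g / 330) * u" by (simp add: algebra_simps)
    then have e: "1 / u \<le> (1 - g / 330) * (1 / (k + d^2))"
      using u kd by (simp add: field_simps)
    have "1 / u * (1 - s / u + (8 * M^2 * s + 8 * s + 6 * s^2) / (u * k)) \<le> 1 / u * (1 + 576 * g / 10^6)"
      using c u by (intro mult_left_mono) auto
    also have "\<dots> \<le> (1 - g / 330) * (1 / (k + d^2)) * (1 + 576 * g / 10^6)"
      using e g by (intro mult_right_mono) auto
    also have "\<dots> = ((1 - g / 330) * (1 + 576 * g / 10^6)) * (1 / (k + d^2))" by simp
    also have "\<dots> \<le> (1 - g / 10^10) * (1 / (k + d^2))"
    proof (rule mult_right_mono)
      have "(1 - g / 330) * (1 + 576 * g / 10^6) = 1 - g * (1/330 - 576/10^6) - g * g * (576 / (330 * 10^6))"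
        by (simp add: field_simps)
      also have "\<dots> \<le> 1 - g * (1/330 - 576/10^6)" using g by simp
      also have "\<dots> \<le> 1 - g / 10^10" using g by (simp add: field_simps)
      finally show "(1 - g / 330) * (1 + 576 * g / 10^6) \<le> 1 - g / 10^10" .
    qed (use kd in simp)
    finally show ?thesis by (simp add: u_def)
  qed
qed

text \<open>The linear term of the expansion around the mean has expectation zero, and
  \<open>X \<ge> 0\<close> bounds the denominator of the remainder below by
  \<open>g\<close>.\<close>

lemma E_inverse_shift_le:
  fixes X :: "'a \<Rightarrow> real"
  assumes fin: "finite (set_pmf P)" and g: "g > 0" and X0: "\<And>y. 0 \<le> X y"
    and m1: "E P X = m" and m2: "E P (\<lambda>y. (X y - m)^2) = s" and m: "0 \<le> m"
  shows "E P (\<lambda>y. 1 / (g + X y)) \<le> 1 / (g + m) * (1 + s / ((g + m) * g))"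
proof -
  define u where "u = g + m"
  have u: "u > 0" using g m by (simp add: u_def)
  have pw: "1 / (g + X y) \<le> 1/u - (1/u^2) * (X y - m) + (1 / (u^2 * g)) * (X y - m)^2" for y
  proof -
    define z where "z = X y - m"
    have ke: "g + X y = u + z" by (simp add: u_def z_def)
    have pos: "u + z \<ge> g" unfolding ke[symmetric] using X0 by simp
    have "1 / (u + z) = 1/u - z/u^2 + z^2 / (u^2 * (u + z))"
      using u pos g by (intro inverse_taylor) auto
    also have "z^2 / (u^2 * (u + z)) \<le> z^2 / (u^2 * g)"
      using u pos g by (intro divide_left_mono mult_left_mono mult_pos_pos) auto
    finally show ?thesis unfolding ke z_def by simp
  qed
  have "E P (\<lambda>y. 1 / (g + X y)) \<le> E P (\<lambda>y. 1/u - (1/u^2) * (X y - m) + (1 / (u^2 * g)) * (X y - m)^2)"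
    by (intro E_mono fin pw)
  also have "\<dots> = 1/u + (1 / (u^2 * g)) * s"
    using fin m1 m2 by (simp add: E_add E_diff)
  also have "\<dots> = 1 / u * (1 + s / (u * g))"
    using u g by (simp add: field_simps power2_eq_square)
  finally show ?thesis unfolding u_def .
qed

lemma alpha_ge:
  assumes "v < n"
  shows "1 / n \<le> alpha n c (c v)"
proof -
  have "card {v} \<le> card {u\<in>{..<n}. c u = c v}" using assms by (intro card_mono) auto
  then show ?thesis by (simp add: alpha_def divide_right_mono)
qed

lemma not_consensusE:
  assumes "valid n k c" "n > 0" "\<not> is_consensus n k c"
  obtains i j where "i \<in> {1..k}" "j \<in> {1..k}" "i \<noteq> j" "1 / n \<le> alpha n c i" "1 / n \<le> alpha n c j"
proof -
  have "c 0 \<in> {1..k}" using assms by (auto simp: valid_def)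
  then obtain v where v: "v < n" "c v \<noteq> c 0"
    using assms(3) unfolding is_consensus_def by blast
  have "c v \<in> {1..k}" using v assms(1) by (auto simp: valid_def)
  then show ?thesis
    using that[of "c 0" "c v"] \<open>c 0 \<in> {1..k}\<close> v assms(2) alpha_ge[of 0 n c] alpha_ge[of v n c] by auto
qed

section \<open>Potentials during a phase\<close>

text \<open>The common interface of both models. Means and variances are summed over the vertices
  because in 2-Choices the law of a vertex depends on its own opinion. The variance bounds are asked
  for only while \<open>gamma n k c \<le> 1.2 * g\<close>, that is, within the phase;
  \<open>var_lower\<close> is what breaks ties between two balanced opinions.\<close>

locale phase =
  fixes n k :: nat and rule :: "nat \<Rightarrow> config \<Rightarrow> nat \<Rightarrow> nat pmf" and g w :: real
  assumes n: "real n \<ge> 2 * 10^6" and k: "k \<le> n"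
    and g: "0 < g" "g \<le> w" "w \<le> 1"
    and large: "10^18 * (ln n)^2 * w \<le> n * g^2"
    and rule_valid: "\<And>c v. valid n k c \<Longrightarrow> v < n \<Longrightarrow> set_pmf (rule n c v) \<subseteq> {1..k}"
    and finite_rule: "\<And>c v. finite (set_pmf (rule n c v))"
    and mean: "\<And>c i. valid n k c \<Longrightarrow> i \<in> {1..k} \<Longrightarrow>
      (\<Sum>v<n. pmf (rule n c v) i) = n * alpha n c i * (1 + alpha n c i - gamma n k c)"
    and var_upper: "\<And>c i. valid n k c \<Longrightarrow> gamma n k c \<le> 1.2 * g \<Longrightarrow> i \<in> {1..k} \<Longrightarrow>
      (\<Sum>v<n. pmf (rule n c v) i * (1 - pmf (rule n c v) i)) \<le> 3 * n * alpha n c i * (w + alpha n c i)"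
    and var_lower: "\<And>c i j. valid n k c \<Longrightarrow> gamma n k c \<le> 1.2 * g \<Longrightarrow> 0.95 * g \<le> gamma n k c \<Longrightarrow>
      i \<in> {1..k} \<Longrightarrow> j \<in> {1..k} \<Longrightarrow> i \<noteq> j \<Longrightarrow>
      0.7 * g \<le> alpha n c i \<Longrightarrow> alpha n c i \<le> 2 * g \<Longrightarrow> 0.7 * g \<le> alpha n c j \<Longrightarrow>
      n * g * w / 400 \<le> (\<Sum>v<n. pmf (rule n c v) i * (1 - pmf (rule n c v) i))"
    and var_alpha: "\<And>c. valid n k c \<Longrightarrow> gamma n k c \<le> 1.2 * g \<Longrightarrow>
      (\<Sum>v<n. Var (rule n c v) (alpha n c)) \<le> 3 * n * g * w"
begin

abbreviation "step \<equiv> sync_step n rule"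
definition l :: real where "l = ln (real n)"

definition band :: "config \<Rightarrow> bool" where
  "band c \<longleftrightarrow> 0.95 * g \<le> gamma n k c \<and> gamma n k c \<le> 1.2 * g"

lemma n_pos: "real n > 0" "n > 0"
  using n by (auto intro: Nat.gr0I)

lemma g_le_1: "g \<le> 1" and w_pos: "w > 0"
  using g by auto

section \<open>Sizes of the parameters\<close>

lemma l_ge_1: "l \<ge> 1"
proof -
  have "3 \<le> real n" using n by simp
  then have "exp 1 \<le> real n" using exp_le by linarith
  then show ?thesis using n_pos ln_ge_iff unfolding l_def by blast
qed

lemma l_w_le: "10^18 * l * w \<le> n * g^2"
proof -
  have "l \<le> l^2" by (rule self_le_power[OF l_ge_1]) simp
  then have "10^18 * l * w \<le> 10^18 * l^2 * w"
    by (rule mult_right_mono[OF mult_left_mono]) (use w_pos in simp_all)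
  then show ?thesis using large unfolding l_def by (rule order_trans)
qed

text \<open>Noise terms take the form \<open>x / (n * g)\<close> and compete with a drift of order
  \<open>g\<close>. The constant \<open>10^18\<close> leaves room for all later factors.\<close>

lemma div_small:
  fixes x :: real
  assumes "10^18 * x \<le> n * g^2"
  shows "x / (n * g) \<le> g / 10^18"
proof -
  have "0 < n * g" using n_pos g by simp
  moreover have "x * 10^18 \<le> g * (n * g)" using assms by (simp only: power2_eq_square mult_ac)
  ultimately show ?thesis
    by (simp only: frac_le_eq divide_le_eq pos_le_divide_eq zero_less_power zero_less_numeral
        times_divide_eq_left if_True times_divide_eq_right)
qed

lemma l2_small: "l^2 * w / (n * g) \<le> g / 10^18"
  by (rule div_small, rule order_trans[OF _ large]) (simp only: mult.assoc l_def)

lemma l_small: "l * w / (n * g) \<le> g / 10^18" "l / (n * g) \<le> 1 / 10^18"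
proof -
  show a: "l * w / (n * g) \<le> g / 10^18"
    by (rule div_small, rule order_trans[OF _ l_w_le]) (simp only: mult.assoc)
  have "l / (n * g) * g \<le> l / (n * g) * w"
    using g l_ge_1 n_pos by (intro mult_left_mono) auto
  also have "\<dots> \<le> (1 / 10^18) * g" using a by simp
  finally have "l / (n * g) * g \<le> (1 / 10^18) * g" .
  then show "l / (n * g) \<le> 1 / 10^18" by (rule mult_right_le_imp_le) (use g in simp)
qed

lemma ng_small: "w / (n * g) \<le> g / 10^18" "1 / (n * g) \<le> 1 / 10^18"
proof -
  have "w / (n * g) \<le> l * w / (n * g)" "1 / (n * g) \<le> l / (n * g)"
    using l_ge_1 w_pos g n_pos by (auto intro!: divide_right_mono)
  then show "w / (n * g) \<le> g / 10^18" "1 / (n * g) \<le> 1 / 10^18" using l_small by linarith+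
qed

lemma nw_ge_1: "n * w \<ge> 1"
proof -
  have "1 / (n * g) \<le> 1" by (rule order_trans[OF ng_small(2)]) simp
  then have "1 \<le> n * g" using n_pos g by (simp add: field_simps)
  also have "\<dots> \<le> n * w" using g by (simp add: mult_left_mono)
  finally show ?thesis .
qed

lemma inverse_n_le_g: "1 / n \<le> g"
proof -
  have "1 / (n * g) \<le> 1" by (rule order_trans[OF ng_small(2)]) simp
  then show ?thesis using n_pos g by (simp add: field_simps)
qed

lemma exp_l: "exp l = n"
  using n_pos by (simp add: l_def)

lemma finite_step: "finite (set_pmf (step c))"
  unfolding sync_step_def by (intro finite_set_Pi_pmf finite_rule) auto

lemma valid_step:
  assumes "valid n k c" "c' \<in> set_pmf (step c)"
  shows "valid n k c'"
  unfolding valid_def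
proof (intro allI impI)
  fix v assume v: "v < n"
  have "c' v \<in> set_pmf (rule n c v)"
    using assms(2) v unfolding sync_step_def by (auto simp: set_Pi_pmf PiE_dflt_def)
  then show "c' v \<in> {1..k}" using rule_valid[OF assms(1) v] by blast
qed

section \<open>Drift of a single weak or strong opinion\<close>

text \<open>The Bernstein bound with weight \<open>t / n\<close> per vertex, which \<open>t\<close>
  at most \<open>n\<close> in absolute value keeps in range. The choice \<open>t = lam\<close>
  serves weak opinions and \<open>t = - lam\<close> strong ones.\<close>

lemma exp_alpha_step:
  fixes t :: real
  assumes "valid n k c" "gamma n k c \<le> 1.2 * g" "i \<in> {1..k}" and t: "\<bar>t\<bar> \<le> n"
  defines "a \<equiv> alpha n c i"
  shows "E (step c) (\<lambda>c'. exp (t * alpha n c' i))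
    \<le> exp (t * a * (1 + a - gamma n k c) + 3 * t^2 / n * a * (w + a))"
proof -
  define u where "u = t / n"
  have u1: "\<bar>u\<bar> \<le> 1" using t n_pos by (simp add: u_def field_simps)
  have "t * alpha n c' i = (\<Sum>v<n. u * of_bool (c' v = i))" for c'
    unfolding alpha_eq_sum u_def sum_distrib_left[symmetric] by simp
  then have "E (step c) (\<lambda>c'. exp (t * alpha n c' i)) = E (step c) (\<lambda>c'. exp (\<Sum>v<n. u * of_bool (c' v = i)))"
    by simp
  also have "\<dots> \<le> exp ((\<Sum>v<n. E (rule n c v) (\<lambda>z. u * of_bool (z = i))) + (\<Sum>v<n. Var (rule n c v) (\<lambda>z. u * of_bool (z = i))))"
    unfolding sync_step_def
  proof (rule E_Pi_exp_bernstein)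
    fix v z
    have "\<bar>u * of_bool (z = i) - u * pmf (rule n c v) i\<bar> = \<bar>u\<bar> * \<bar>of_bool (z = i) - pmf (rule n c v) i\<bar>"
      by (simp flip: right_diff_distrib abs_mult)
    also have "\<dots> \<le> 1 * 1" using u1 by (intro mult_mono abs_of_bool_diff) auto
    finally show "\<bar>u * of_bool (z = i) - E (rule n c v) (\<lambda>z. u * of_bool (z = i))\<bar> \<le> 1"
      by (simp add: E_of_bool)
  qed (auto simp: finite_rule)
  also have "(\<Sum>v<n. E (rule n c v) (\<lambda>z. u * of_bool (z = i))) = u * (n * a * (1 + a - gamma n k c))"
    using mean[OF assms(1,3)] by (simp add: E_of_bool flip: sum_distrib_left add: a_def)
  also have "(\<Sum>v<n. Var (rule n c v) (\<lambda>z. u * of_bool (z = i))) = u^2 * (\<Sum>v<n. pmf (rule n c v) i * (1 - pmf (rule n c v) i))"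
    by (simp add: Var_scale Var_of_bool finite_rule sum_distrib_left)
  also have "\<dots> \<le> u^2 * (3 * n * a * (w + a))"
    using var_upper[OF assms(1,2,3)] by (intro mult_left_mono) (auto simp: a_def)
  also have "u * (n * a * (1 + a - gamma n k c)) = t * a * (1 + a - gamma n k c)"
    using n_pos by (simp add: u_def)
  also have "u^2 * (3 * n * a * (w + a)) = 3 * t^2 / n * a * (w + a)"
    using n_pos by (simp add: u_def power2_eq_square field_simps)
  finally show ?thesis by simp
qed

text \<open>With this scale \<open>exp (lam * (x * g))\<close> is \<open>n\<close> to the power
  \<open>100 * x\<close>, so positions relative to \<open>g\<close> become powers of
  \<open>n\<close>.\<close>

definition lam :: real where "lam = 100 * l / g"

lemma lam_pos: "lam > 0" using l_ge_1 g by (simp add: lam_def)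

lemma lam_g: "lam * (x * g) = 100 * x * l"
  using g by (simp add: lam_def)

lemma lam_small: "lam / n * w \<le> g / 10^15" "lam / n \<le> 1 / 10^15" "lam \<le> n"
proof -
  have "lam / n * w = 100 * (l * w / (n * g))" "lam / n = 100 * (l / (n * g))"
    using n_pos g by (auto simp: lam_def field_simps)
  moreover have "100 * (l * w / (n * g)) \<le> 100 * (g / 10^18)" "100 * (l / (n * g)) \<le> 100 * (1 / 10^18)"
    by (rule mult_left_mono, rule l_small, simp)+
  ultimately show 1: "lam / n * w \<le> g / 10^15" "lam / n \<le> 1 / 10^15"
    using g by auto
  have "lam / n \<le> 1" by (rule order_trans[OF 1(2)]) simp
  then show "lam \<le> n" using n_pos by (simp add: field_simps)
qed

lemma lam_noise:
  assumes "0 \<le> a"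
  shows "lam / n * (w + a) \<le> (g + a) / 10^15"
proof -
  have "lam / n * a \<le> 1 / 10^15 * a" using lam_small assms by (intro mult_right_mono) auto
  moreover have "lam / n * (w + a) = lam / n * w + lam / n * a" by (rule distrib_left)
  moreover have "(g + a) / 10^15 = g / 10^15 + 1 / 10^15 * a" by simp
  ultimately show ?thesis using lam_small(1) by linarith
qed

text \<open>Subtracting 1 makes the potential vanish at extinction, and lets convexity turn a
  shrinking exponent into a shrinking potential.\<close>

definition V :: "nat \<Rightarrow> config \<Rightarrow> real" where
  "V i c = exp (lam * alpha n c i) - 1"

text \<open>As \<open>gamma n k c\<close> exceeds \<open>alpha n c i\<close> by at least
  \<open>0.15 * g\<close>, the mean shrinks by that rate, and the noise uses up less than
  \<open>0.05 * g\<close> of it.\<close>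

lemma V_step:
  assumes c: "valid n k c" "band c" and i: "i \<in> {1..k}" and weak: "alpha n c i \<le> 0.8 * g"
  shows "E (step c) (V i) \<le> (1 - g / 10^10) * V i c"
proof -
  define a where "a = alpha n c i"
  have a0: "0 \<le> a" by (simp add: a_def alpha_nonneg)
  have b: "0.95 * g \<le> gamma n k c" "gamma n k c \<le> 1.2 * g" using c by (auto simp: band_def)
  have EV: "E (step c) (V i) = E (step c) (\<lambda>c'. exp (lam * alpha n c' i)) - 1"
    unfolding V_def by (simp add: E_diff[OF finite_step])
  have "E (step c) (\<lambda>c'. exp (lam * alpha n c' i))
    \<le> exp (lam * a * (1 + a - gamma n k c) + 3 * lam^2 / n * a * (w + a))"
    unfolding a_def using c b i lam_small lam_pos by (intro exp_alpha_step) auto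
  also have "lam * a * (1 + a - gamma n k c) + 3 * lam^2 / n * a * (w + a)
     = lam * a * (1 + a - gamma n k c + 3 * (lam / n * (w + a)))"
    by (simp add: power2_eq_square field_simps)
  also have "exp (lam * a * (1 + a - gamma n k c + 3 * (lam / n * (w + a)))) \<le> exp (lam * a * (1 - 0.1 * g))"
  proof -
    have "1 + a - gamma n k c + 3 * (lam / n * (w + a)) \<le> 1 - 0.1 * g"
      using lam_noise[OF a0] weak b g by (simp add: a_def)
    then have "lam * a * (1 + a - gamma n k c + 3 * (lam / n * (w + a))) \<le> lam * a * (1 - 0.1 * g)"
      using lam_pos a0 by (intro mult_left_mono) auto
    then show ?thesis by simp
  qed
  \<comment> \<open>Convexity of \<open>exp\<close> between \<open>0\<close> and
    \<open>lam * a\<close>.\<close>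
  also have "exp (lam * a * (1 - 0.1 * g)) \<le> (1 - 0.1 * g) * exp (lam * a) + 0.1 * g"
    using convex_onD[OF exp_convex, of "1 - 0.1 * g" 0 "lam * a"] g g_le_1 by (simp add: mult_ac)
  finally have "E (step c) (V i) \<le> (1 - 0.1 * g) * exp (lam * a) + 0.1 * g - 1"
    unfolding EV by simp
  also have "\<dots> = (1 - 0.1 * g) * V i c"
    by (simp add: V_def a_def algebra_simps)
  also have "\<dots> \<le> (1 - g / 10^10) * V i c"
    using g lam_pos alpha_nonneg by (intro mult_right_mono) (auto simp: V_def)
  finally show ?thesis .
qed

text \<open>The second summand keeps \<open>U\<close> polynomially bounded below, also when \<open>alpha n c i\<close> is much
  larger than \<open>g\<close>.\<close>

definition U :: "nat \<Rightarrow> config \<Rightarrow> real" where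
  "U i c = exp (- lam * alpha n c i) + exp (- 170 * l) * g * (1 / (g + alpha n c i))"

lemma alpha_moments:
  assumes c: "valid n k c" "gamma n k c \<le> 1.2 * g" and i: "i \<in> {1..k}"
  defines "a \<equiv> alpha n c i"
  defines "m \<equiv> a * (1 + a - gamma n k c)"
  shows "E (step c) (\<lambda>c'. alpha n c' i) = m"
    and "E (step c) (\<lambda>c'. (alpha n c' i - m)^2) \<le> 3 * a * (w + a) / n"
proof -
  let ?X = "\<lambda>c'. \<Sum>v<n. of_bool (c' v = i) :: real"
  have b: "\<bar>of_bool (z = i) - pmf (rule n c v) i\<bar> \<le> 2" for z v
    by (rule order_trans[OF abs_of_bool_diff]) simp
  have sm: "(\<Sum>v<n. E (rule n c v) (\<lambda>z. of_bool (z = i))) = n * m"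
    using mean[OF c(1) i] by (simp add: E_of_bool m_def a_def)
  note mom = E_Pi_moments[of "{..<n}" "rule n c" "\<lambda>v z. of_bool (z = i)" 0, unfolded E_of_bool,
      OF _ finite_rule b, folded sync_step_def]
  have "E (step c) ?X = n * m" using mom(1) sm by (simp add: E_of_bool)
  then show "E (step c) (\<lambda>c'. alpha n c' i) = m" using n_pos by (simp add: alpha_eq_sum)
  have eq: "(alpha n c' i - m)^2 = (1 / n^2) * (?X c' - n * m)^2" for c'
    using n_pos by (simp add: alpha_eq_sum power2_eq_square field_simps)
  have "E (step c) (\<lambda>c'. (alpha n c' i - m)^2)
      = (1 / n^2) * (\<Sum>v<n. Var (rule n c v) (\<lambda>z. of_bool (z = i)))"
    unfolding eq using mom(2) sm by (simp add: E_of_bool)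
  also have "\<dots> \<le> (1 / n^2) * (3 * n * a * (w + a))"
    using var_upper[OF c i] by (intro mult_left_mono) (auto simp: a_def Var_of_bool finite_rule)
  also have "\<dots> = 3 * a * (w + a) / n" using n_pos by (simp add: power2_eq_square)
  finally show "E (step c) (\<lambda>c'. (alpha n c' i - m)^2) \<le> 3 * a * (w + a) / n" .
qed

text \<open>Here \<open>alpha n c i\<close> exceeds \<open>gamma n k c\<close> by at least
  \<open>0.3 * g\<close>, so after noise the exponent still falls by a relative
  \<open>0.1 * g\<close>. Since \<open>lam * a \<ge> 10\<close>, this is an absolute fall by at
  least \<open>g\<close>.\<close>

lemma exp_neg_alpha_step:
  assumes c: "valid n k c" "gamma n k c \<le> 1.2 * g" and i: "i \<in> {1..k}" and strong: "1.5 * g \<le> alpha n c i"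
  shows "E (step c) (\<lambda>c'. exp (- lam * alpha n c' i)) \<le> (1 - g / 10^10) * exp (- lam * alpha n c i)"
proof -
  define a where "a = alpha n c i"
  have a: "1.5 * g \<le> a" "0 \<le> a" using strong g by (auto simp: a_def)
  have "E (step c) (\<lambda>c'. exp (- lam * alpha n c' i))
    \<le> exp (- lam * a * (1 + a - gamma n k c) + 3 * (-lam)^2 / n * a * (w + a))"
    unfolding a_def using c i lam_small lam_pos by (intro exp_alpha_step) auto
  also have "- lam * a * (1 + a - gamma n k c) + 3 * (-lam)^2 / n * a * (w + a)
     = lam * a * (- 1 - a + gamma n k c + 3 * (lam / n * (w + a)))"
    by (simp add: power2_eq_square field_simps)
  also have "\<dots> \<le> lam * a * (-1 - 0.1 * g)"
    using lam_noise[OF a(2)] c(2) lam_pos a g by (intro mult_left_mono) auto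
  also have "\<dots> \<le> - lam * a - g"
  proof -
    have "lam * (1.5 * g) \<le> lam * a" using lam_pos a by (intro mult_left_mono) auto
    then have "10 \<le> lam * a" using lam_g[of "1.5"] l_ge_1 by linarith
    then have "10 * (0.1 * g) \<le> lam * a * (0.1 * g)" using g by (intro mult_right_mono) auto
    then show ?thesis by (simp add: algebra_simps)
  qed
  finally have "E (step c) (\<lambda>c'. exp (- lam * alpha n c' i)) \<le> exp (- lam * a - g)" by simp
  also have "\<dots> = exp (-g) * exp (- lam * a)" by (subst exp_add[symmetric]) simp
  also have "exp (-g) \<le> 1 - g / 10^10"
  proof -
    have "(1 - g/10^10) * (1 + g) \<ge> 1" using g g_le_1 mult_left_le_one_le[of g g] by (simp add: algebra_simps)
    also have "(1 - g/10^10) * (1 + g) \<le> (1 - g/10^10) * exp g"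
      using g_le_1 g by (intro mult_left_mono) auto
    finally show ?thesis by (simp add: exp_minus field_simps)
  qed
  finally show ?thesis by (simp add: a_def)
qed

text \<open>From \<open>1.5 * g \<le> a\<close> follows \<open>gamma n k c \<le> 0.8 * a\<close>.
  The relative drift is thus at least \<open>0.2 * a\<close> and dominates the noise
  \<open>0.005 * a\<close>, however far \<open>a\<close> is above \<open>g\<close>.\<close>

lemma inverse_alpha_step:
  assumes c: "valid n k c" "gamma n k c \<le> 1.2 * g" and i: "i \<in> {1..k}" and strong: "1.5 * g \<le> alpha n c i"
  shows "E (step c) (\<lambda>c'. 1 / (g + alpha n c' i)) \<le> (1 - g / 10^10) * (1 / (g + alpha n c i))"
proof -
  define a where "a = alpha n c i"
  define m where "m = a * (1 + a - gamma n k c)"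
  define s where "s = E (step c) (\<lambda>c'. (alpha n c' i - m)^2)"
  have a: "1.5 * g \<le> a" "0 < a" "a \<le> 1" using strong g by (auto simp: a_def alpha_le_1)
  have ma: "a * (1 + 0.2 * a) \<le> m" unfolding m_def using a c by (intro mult_left_mono) auto
  have "a * 1 \<le> a * (1 + 0.2 * a)" using a by (intro mult_left_mono) auto
  then have am: "a \<le> m" using ma by simp
  note mom = alpha_moments[OF c i, folded a_def, folded m_def]
  have gm: "0 < g + m" using g a am by simp
  have "s / ((g + m) * g) \<le> (3 * a * (w + a) / n) / ((g + m) * g)"
    using mom(2) gm g by (intro divide_right_mono) (auto simp: s_def)
  also have "\<dots> = (a / (g + m)) * (3 * (w / (n * g)) + 3 * a * (1 / (n * g)))"
    using gm g n_pos by (simp add: field_simps)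
  also have "\<dots> \<le> 1 * (3 * (g / 10^18) + 3 * a * (1 / 10^18))"
    using am gm g w_pos a ng_small by (intro mult_mono add_mono) (auto simp: mult_nonneg_nonneg)
  also have "\<dots> \<le> 0.005 * a" using a by simp
  finally have noise: "s / ((g + m) * g) \<le> 0.005 * a" .
  have "(g + a) \<le> (1 - 0.1 * a) * (g + m)"
  proof -
    \<comment> \<open>This is the surplus of the claim once \<open>m\<close> is replaced by its
      lower bound \<open>a * (1 + 0.2 * a)\<close>.\<close>
    have "0 \<le> a * (0.1 * a - 0.1 * g - 1/50 * a * a)"
    proof (rule mult_nonneg_nonneg)
      have "a * a \<le> a * 1" using a by (intro mult_left_mono) auto
      then show "0 \<le> 0.1 * a - 0.1 * g - 1/50 * a * a" using a by linarith
    qed (use a in simp)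
    then have "g + a \<le> (1 - 0.1 * a) * (g + a * (1 + 0.2 * a))" by (simp add: algebra_simps)
    also have "\<dots> \<le> (1 - 0.1 * a) * (g + m)" using ma a by (intro mult_left_mono) auto
    finally show ?thesis .
  qed
  then have drift: "1 / (g + m) \<le> (1 - 0.1 * a) * (1 / (g + a))"
    using gm g a by (simp add: field_simps)
  have "E (step c) (\<lambda>c'. 1 / (g + alpha n c' i)) \<le> 1 / (g + m) * (1 + s / ((g + m) * g))"
    using finite_step g mom am a by (intro E_inverse_shift_le) (auto simp: alpha_nonneg s_def)
  also have "\<dots> \<le> ((1 - 0.1 * a) * (1 / (g + a))) * (1 + 0.005 * a)"
    using drift noise gm a g by (intro mult_mono) (auto simp: s_def)
  also have "\<dots> = ((1 - 0.1 * a) * (1 + 0.005 * a)) * (1 / (g + a))" by simp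
  also have "\<dots> \<le> (1 - g / 10^10) * (1 / (g + a))"
  proof (rule mult_right_mono)
    have "(1 - 0.1 * a) * (1 + 0.005 * a) = 1 - 0.095 * a - 0.0005 * (a * a)" by (simp add: field_simps)
    also have "\<dots> \<le> 1 - 0.095 * a" by simp
    also have "\<dots> \<le> 1 - g / 10^10" using a g by simp
    finally show "(1 - 0.1 * a) * (1 + 0.005 * a) \<le> 1 - g / 10^10" .
  qed (use g a in auto)
  finally show ?thesis by (simp add: a_def)
qed

lemma U_step:
  assumes c: "valid n k c" "band c" and i: "i \<in> {1..k}" and strong: "1.5 * g \<le> alpha n c i"
  shows "E (step c) (U i) \<le> (1 - g / 10^10) * U i c"
proof -
  define e where "e = exp (- 170 * l) * g"
  have e0: "e \<ge> 0" using g by (simp add: e_def)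
  have b: "gamma n k c \<le> 1.2 * g" using c by (simp add: band_def)
  have "E (step c) (U i) = E (step c) (\<lambda>c'. exp (- lam * alpha n c' i)) + e * E (step c) (\<lambda>c'. 1 / (g + alpha n c' i))"
    unfolding U_def e_def[symmetric] by (simp only: E_add[OF finite_step] integral_mult_right_zero)
  also have "\<dots> \<le> (1 - g / 10^10) * exp (- lam * alpha n c i) + e * ((1 - g / 10^10) * (1 / (g + alpha n c i)))"
    by (intro add_mono mult_left_mono exp_neg_alpha_step inverse_alpha_step c b i strong e0)
  also have "\<dots> = (1 - g / 10^10) * U i c"
    unfolding U_def e_def[symmetric] by (simp only: distrib_left mult.left_commute[of e])
  finally show ?thesis .
qed

section \<open>The gap between two comparable opinions\<close>

text \<open>The gap of the two counts has variance of order \<open>n * g * w\<close> per round, so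
  \<open>n * w\<close> is the scale to which it diffuses in \<open>1 / g\<close> rounds.\<close>

definition Phi :: "nat \<Rightarrow> nat \<Rightarrow> config \<Rightarrow> real" where
  "Phi i j c = 1 / (10^6 * (n * w) + (n * alpha n c i - n * alpha n c j)^2)"

text \<open>The gap \<open>d\<close> moves in mean to \<open>d * (1 + r)\<close> with
  \<open>r = a + b - gamma n k c\<close>, and \<open>r \<ge> 1.4 * g - 1.2 * g = g / 5\<close>. The
  sums of independent indicator differences supply the moments for the reciprocal estimate.\<close>

lemma Phi_step:
  assumes c: "valid n k c" "band c" and i: "i \<in> {1..k}" and j: "j \<in> {1..k}" and ij: "i \<noteq> j"
    and ai: "0.7 * g \<le> alpha n c i" "alpha n c i \<le> 2 * g"
    and aj: "0.7 * g \<le> alpha n c j" "alpha n c j \<le> 2 * g"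
  shows "E (step c) (Phi i j) \<le> (1 - g / 10^10) * Phi i j c"
proof -
  define a where "a = alpha n c i"
  define b where "b = alpha n c j"
  define d where "d = n * a - n * b"
  define r where "r = a + b - gamma n k c"
  let ?f = "\<lambda>z. of_bool (z = i) - of_bool (z = j) :: real"
  define s where "s = (\<Sum>v<n. Var (rule n c v) ?f)"
  define X where "X = (\<lambda>c'. \<Sum>v<n. ?f (c' v))"
  define h where "h = real n * w"
  have band: "0.95 * g \<le> gamma n k c" "gamma n k c \<le> 1.2 * g" using c by (auto simp: band_def)
  have Ef: "E (rule n c v) ?f = pmf (rule n c v) i - pmf (rule n c v) j" for v
    by (simp add: E_diff finite_rule E_of_bool)
  have bd: "\<bar>?f z - E (rule n c v) ?f\<bar> \<le> 2" for z v
    using abs_of_bool_diff[of "z = i" "rule n c v" i] abs_of_bool_diff[of "z = j" "rule n c v" j]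
    unfolding Ef by linarith
  have "(\<Sum>v<n. E (rule n c v) ?f) = n * a * (1 + a - gamma n k c) - n * b * (1 + b - gamma n k c)"
    unfolding Ef sum_subtractf using mean[OF c(1) i] mean[OF c(1) j] by (simp add: a_def b_def)
  also have "\<dots> = d * (1 + r)" by (simp add: d_def r_def algebra_simps)
  finally have sm: "(\<Sum>v<n. E (rule n c v) ?f) = d * (1 + r)" .
  note mom = E_Pi_moments[of "{..<n}" "rule n c" "\<lambda>v. ?f" 0, OF _ finite_rule bd, folded sync_step_def,
      unfolded sm, folded s_def]
  have XP: "Phi i j c' = 1 / (10^6 * h + (X c')^2)" for c'
    using n_pos by (simp add: Phi_def h_def X_def alpha_eq_sum sum_subtractf)
  have "E (step c) (\<lambda>c'. 1 / (10^6 * h + (X c')^2))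
    \<le> 1 / (10^6 * h + (d * (1 + r))^2) * (1 - s / (10^6 * h + (d * (1 + r))^2)
       + (8 * (d * (1 + r))^2 * s + 8 * s + 6 * s^2) / ((10^6 * h + (d * (1 + r))^2) * (10^6 * h)))"
    using mom finite_step nw_ge_1 unfolding X_def by (intro E_inverse_square_le) (simp_all add: h_def)
  also have "\<dots> \<le> (1 - g / 10^10) * (1 / (10^6 * h + d^2))"
  proof (rule inverse_square_contraction)
    have "a + b = (\<Sum>i\<in>{i, j}. alpha n c i)" using ij by (simp add: a_def b_def)
    also have "\<dots> \<le> (\<Sum>i\<in>{1..k}. alpha n c i)" using i j by (intro sum_mono2) (auto simp: alpha_nonneg)
    also have "\<dots> = 1" using c n_pos by (intro sum_alpha) auto
    finally show "r \<le> 1" using gamma_nonneg[of n k c] by (simp add: r_def)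
    show "g / 5 \<le> r" using ai aj band by (simp add: r_def a_def b_def)
    show "h \<ge> 1" using nw_ge_1 by (simp add: h_def)
    let ?v = "\<lambda>i. \<Sum>v<n. pmf (rule n c v) i * (1 - pmf (rule n c v) i)"
    have "h * g / 400 \<le> ?v i"
      using var_lower[OF c(1) band(2,1) i j ij ai aj(1)] by (simp add: h_def mult_ac)
    also have "\<dots> \<le> s" unfolding s_def by (intro sum_mono Var_of_bool_diff finite_rule ij)
    finally show "h * g / 400 \<le> s" .
    \<comment> \<open>The constant 18 is \<open>3 * 2 * 3\<close>, from
      \<open>alpha n c m \<le> 2 * g \<le> 2 * w\<close>. Two opinions and the factor 2 of
      \<open>Var_of_bool_diff\<close> make it 72.\<close>
    have vu: "?v m \<le> 18 * h * g" if m: "m \<in> {1..k}" "alpha n c m \<le> 2 * g" for m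
    proof -
      have "?v m \<le> 3 * n * alpha n c m * (w + alpha n c m)" by (rule var_upper[OF c(1) band(2) m(1)])
      also have "\<dots> \<le> 3 * n * (2 * g) * (w + 2 * w)"
        using m g alpha_nonneg[of n c m] w_pos by (intro mult_mono add_mono) auto
      finally show ?thesis by (simp add: h_def mult_ac)
    qed
    have "s \<le> (\<Sum>v<n. 2 * (pmf (rule n c v) i * (1 - pmf (rule n c v) i) + pmf (rule n c v) j * (1 - pmf (rule n c v) j)))"
      unfolding s_def by (intro sum_mono Var_of_bool_diff finite_rule ij)
    also have "\<dots> = 2 * (?v i + ?v j)" by (simp add: sum.distrib sum_distrib_left)
    also have "\<dots> \<le> 72 * h * g" using vu[OF i ai(2)] vu[OF j aj(2)] by simp
    finally show "s \<le> 72 * h * g" .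
  qed (use g g_le_1 in auto)
  also have "1 / (10^6 * h + d^2) = Phi i j c" by (simp add: Phi_def h_def d_def a_def b_def)
  also have "(\<lambda>c'. 1 / (10^6 * h + (X c')^2)) = Phi i j" by (intro ext XP[symmetric])
  finally show ?thesis .
qed

section \<open>Stability of \<open>gamma\<close> during a phase\<close>

text \<open>The tangent at the old configuration lies below the convex \<open>gamma\<close>. It is
  linear in the independent choices \<open>c' v\<close>, so exponential moments apply to it.\<close>

lemma gamma_step_lower:
  assumes "valid n k c" "valid n k c'"
  shows "2 / n * (\<Sum>v<n. alpha n c (c' v)) - gamma n k c \<le> gamma n k c'"
proof -
  have "0 \<le> (\<Sum>i\<in>{1..k}. (alpha n c' i - alpha n c i)^2)" by (intro sum_nonneg) auto
  also have "\<dots> = gamma n k c' - 2 * (\<Sum>i\<in>{1..k}. alpha n c' i * alpha n c i) + gamma n k c"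
    by (simp add: gamma_def power2_eq_square algebra_simps sum.distrib sum_subtractf sum_distrib_left)
  also have "(\<Sum>i\<in>{1..k}. alpha n c' i * alpha n c i) = (\<Sum>v<n. alpha n c (c' v)) / n"
    by (rule sum_alpha_mult[OF assms(2)])
  finally show ?thesis by simp
qed

text \<open>As \<open>lam2 * (0.05 * g) = 85 * l\<close>, a fall from \<open>g\<close> to
  \<open>0.95 * g\<close> is weighted by \<open>exp (85 * l)\<close>, more than the growth
  \<open>exp (82 * l)\<close> collected during a phase.\<close>

definition lam2 :: real where "lam2 = 1700 * l / g"

lemma lam2_pos: "lam2 > 0" using l_ge_1 g by (simp add: lam2_def)

lemma exp_gamma_step:
  assumes c: "valid n k c" "gamma n k c \<le> 1.2 * g"
  shows "E (step c) (\<lambda>c'. exp (- lam2 * gamma n k c')) \<le> exp (g / 10^10) * exp (- lam2 * gamma n k c)"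
proof -
  define t where "t = 2 * lam2 / n"
  have "t = 3400 * (l / (n * g))" using n_pos g by (simp add: t_def lam2_def field_simps)
  then have "t \<le> 3400 * (1 / 10^18)" using l_small by simp
  then have t1: "t \<le> 1" by (rule order_trans) simp
  have t0: "0 \<le> t" using lam2_pos n_pos by (simp add: t_def)
  note t1 = t0 t1
  let ?a = "alpha n c"
  have red: "E (step c) (\<lambda>c'. exp (- lam2 * gamma n k c'))
    \<le> E (step c) (\<lambda>c'. exp (lam2 * gamma n k c) * exp (\<Sum>v<n. - t * ?a (c' v)))"
  proof (rule E_mono[OF finite_step])
    fix c' assume "c' \<in> set_pmf (step c)"
    then have "valid n k c'" using c valid_step by blast
    from gamma_step_lower[OF c(1) this]
    have "lam2 * (2 / n * (\<Sum>v<n. ?a (c' v)) - gamma n k c) \<le> lam2 * gamma n k c'"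
      using lam2_pos by (intro mult_left_mono) auto
    moreover have "(\<Sum>v<n. - t * ?a (c' v)) = - t * (\<Sum>v<n. ?a (c' v))"
      by (simp only: sum_distrib_left)
    ultimately have "- lam2 * gamma n k c' \<le> lam2 * gamma n k c + (\<Sum>v<n. - t * ?a (c' v))"
      by (simp add: t_def algebra_simps)
    then show "exp (- lam2 * gamma n k c') \<le> exp (lam2 * gamma n k c) * exp (\<Sum>v<n. - t * ?a (c' v))"
      by (simp flip: exp_add)
  qed
  have "E (step c) (\<lambda>c'. exp (\<Sum>v<n. - t * ?a (c' v)))
      \<le> exp ((\<Sum>v<n. E (rule n c v) (\<lambda>z. - t * ?a z)) + (\<Sum>v<n. Var (rule n c v) (\<lambda>z. - t * ?a z)))"
    unfolding sync_step_def
  proof (rule E_Pi_exp_bernstein)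
    fix v z
    let ?m = "E (rule n c v) ?a"
    have m: "0 \<le> ?m" "?m \<le> 1"
      using alpha_nonneg alpha_le_1 finite_rule by (auto intro: E_const_le)
    have "\<bar>t * (?m - ?a z)\<bar> = t * \<bar>?m - ?a z\<bar>" using t1 by (simp add: abs_mult)
    also have "\<dots> \<le> 1 * 1" using t1 m alpha_nonneg[of n c z] alpha_le_1[of n c z] by (intro mult_mono) auto
    finally show "\<bar>- t * ?a z - E (rule n c v) (\<lambda>z. - t * ?a z)\<bar> \<le> 1"
      by (simp add: algebra_simps)
  qed (auto simp: finite_rule)
  also have "(\<Sum>v<n. E (rule n c v) (\<lambda>z. - t * ?a z)) = - t * (\<Sum>v<n. E (rule n c v) ?a)"
    by (simp add: sum_distrib_left)
  also have "(\<Sum>v<n. E (rule n c v) ?a) = (\<Sum>v<n. \<Sum>i\<in>{1..k}. ?a i * pmf (rule n c v) i)"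
  proof (rule sum.cong)
    fix v assume "v \<in> {..<n}"
    then have "set_pmf (rule n c v) \<subseteq> {1..k}" using rule_valid[OF c(1)] by auto
    then show "E (rule n c v) ?a = (\<Sum>i\<in>{1..k}. ?a i * pmf (rule n c v) i)"
      by (intro integral_measure_pmf_real) auto
  qed simp
  also have "\<dots> = (\<Sum>i\<in>{1..k}. ?a i * (\<Sum>v<n. pmf (rule n c v) i))"
    by (subst sum.swap) (simp add: sum_distrib_left)
  also have "\<dots> = (\<Sum>i\<in>{1..k}. ?a i * (n * ?a i * (1 + ?a i - gamma n k c)))"
    by (intro sum.cong) (auto simp: mean[OF c(1)])
  also have "\<dots> = n * (gamma n k c + ((\<Sum>i\<in>{1..k}. (?a i)^3) - (gamma n k c)^2))"
    by (simp add: gamma_def power2_eq_square power3_eq_cube algebra_simps sum.distrib sum_subtractf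
        sum_distrib_left sum_distrib_right)
  also have "(\<Sum>v<n. Var (rule n c v) (\<lambda>z. - t * ?a z)) = t^2 * (\<Sum>v<n. Var (rule n c v) ?a)"
    by (simp only: Var_scale sum_distrib_left power2_minus)
  also have "exp (- t * (n * (gamma n k c + ((\<Sum>i\<in>{1..k}. (?a i)^3) - (gamma n k c)^2))) + t^2 * (\<Sum>v<n. Var (rule n c v) ?a))
      \<le> exp (- t * (n * gamma n k c) + t^2 * (3 * n * g * w))"
  proof -
    \<comment> \<open>The drift of \<open>gamma\<close> is nonnegative and is dropped; only the
      noise is left to control.\<close>
    have "t * (n * gamma n k c) \<le> t * (n * (gamma n k c + ((\<Sum>i\<in>{1..k}. (?a i)^3) - (gamma n k c)^2)))"
      using t1 n_pos gamma_sq_le_sum_cubes[OF c(1) n_pos(2)] by (intro mult_left_mono) auto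
    moreover have "t^2 * (\<Sum>v<n. Var (rule n c v) ?a) \<le> t^2 * (3 * n * g * w)"
      by (intro mult_left_mono var_alpha c) auto
    ultimately show ?thesis by simp
  qed
  also have "\<dots> \<le> exp (g / 10^10 - 2 * lam2 * gamma n k c)"
  proof -
    \<comment> \<open>As \<open>t\<close> is of order \<open>l / (n * g)\<close>, the square of the
      logarithm in \<open>large\<close> is needed here.\<close>
    have "t^2 * (3 * n * g * w) = 12 * 1700^2 * (l^2 * w / (n * g))"
      using n_pos g by (simp add: t_def lam2_def field_simps power2_eq_square)
    also have "\<dots> \<le> 12 * 1700^2 * (g / 10^18)"
      using l2_small by (rule mult_left_mono) simp
    also have "\<dots> \<le> g / 10^10" using g by simp
    finally have "t^2 * (3 * n * g * w) \<le> g / 10^10" .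
    moreover have "t * (n * gamma n k c) = 2 * lam2 * gamma n k c" using n_pos by (simp add: t_def)
    ultimately show ?thesis unfolding exp_le_cancel_iff by linarith
  qed
  finally have "exp (lam2 * gamma n k c) * E (step c) (\<lambda>c'. exp (\<Sum>v<n. - t * ?a (c' v)))
      \<le> exp (lam2 * gamma n k c) * exp (g / 10^10 - 2 * lam2 * gamma n k c)"
    by (intro mult_left_mono) auto
  also have "\<dots> = exp (g / 10^10) * exp (- lam2 * gamma n k c)"
    by (simp flip: exp_add)
  finally show ?thesis using red by simp
qed

section \<open>The minimum of the potentials of a pair\<close>

lemma exp_l_ge: "x \<le> y \<Longrightarrow> exp (x * l) \<le> exp (y * l)"
  using l_ge_1 by (simp add: mult_right_mono)

lemma two_exp: "x + 1 \<le> y \<Longrightarrow> 2 * exp (x * l) \<le> exp (y * l)"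
proof -
  assume xy: "x + 1 \<le> y"
  have "2 * exp (x * l) \<le> n * exp (x * l)" using n by (intro mult_right_mono) auto
  also have "\<dots> = exp ((x + 1) * l)" by (simp add: exp_l[symmetric] exp_add[symmetric] algebra_simps)
  also have "\<dots> \<le> exp (y * l)" by (rule exp_l_ge[OF xy])
  finally show ?thesis .
qed

lemma exp_ge_1: "0 \<le> x \<Longrightarrow> 1 \<le> exp (x * l)"
  using l_ge_1 by simp

text \<open>The exponents are chosen such that, as a function of \<open>alpha n c i\<close>, \<open>V\<close> crosses the range of \<open>RPhi\<close>
  between \<open>0.7 * g\<close> and \<open>0.8 * g\<close>, and \<open>RU\<close> crosses it between \<open>1.5 * g\<close> and \<open>2 * g\<close>.\<close>

definition RPhi :: "nat \<Rightarrow> nat \<Rightarrow> config \<Rightarrow> real" where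
  "RPhi i j c = exp (75 * l) * Phi i j c"

definition RU :: "nat \<Rightarrow> config \<Rightarrow> real" where
  "RU i c = exp (230 * l) * U i c"

text \<open>The denominator of \<open>Phi\<close> lies between 1 and \<open>2 * n^2\<close>. The
  range is thus a few powers of \<open>n\<close> wide, which \<open>V\<close> and \<open>RU\<close>
  cross within a short interval of \<open>alpha\<close>.\<close>

lemma RPhi_bounds: "exp (72 * l) \<le> RPhi i j c" "RPhi i j c \<le> exp (75 * l)"
proof -
  define D where "D = 10^6 * (n * w) + (n * alpha n c i - n * alpha n c j)^2"
  have D: "1 \<le> D" using nw_ge_1 by (simp add: D_def add_increasing2)
  have "RPhi i j c \<le> exp (75 * l) * 1"
    unfolding RPhi_def Phi_def D_def[symmetric] using D by (intro mult_left_mono) auto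
  then show "RPhi i j c \<le> exp (75 * l)" by simp
  have "(n * alpha n c i - n * alpha n c j)^2 = (real n)^2 * (alpha n c i - alpha n c j)^2"
    by (simp add: power_mult_distrib flip: right_diff_distrib)
  also have "\<dots> \<le> (real n)^2 * 1"
  proof (intro mult_left_mono)
    have "\<bar>alpha n c i - alpha n c j\<bar> \<le> 1"
      using alpha_nonneg[of n c i] alpha_nonneg[of n c j] alpha_le_1[of n c i] alpha_le_1[of n c j] by linarith
    then show "(alpha n c i - alpha n c j)^2 \<le> 1" by (simp add: abs_square_le_1)
  qed auto
  moreover have "10^6 * (n * w) \<le> real n * real n"
    using n g by (intro mult_mono) (auto intro: mult_left_le order_trans)
  ultimately have D2: "D \<le> 2 * n^2" by (simp add: D_def power2_eq_square)
  have n2: "real n ^ 2 = exp (2 * l)" by (simp add: exp_l[symmetric] exp_double)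
  have "exp (72 * l) * D \<le> exp (72 * l) * (2 * exp (2 * l))"
    using D2 n2 by (intro mult_left_mono) auto
  also have "\<dots> = 2 * exp (74 * l)" by (simp flip: exp_add)
  also have "\<dots> \<le> exp (75 * l)" by (rule two_exp) simp
  finally show "exp (72 * l) \<le> RPhi i j c"
    unfolding RPhi_def Phi_def D_def[symmetric] using D by (simp add: field_simps)
qed

lemma V_low: "alpha n c i < 0.7 * g \<Longrightarrow> V i c < exp (72 * l)"
proof -
  assume "alpha n c i < 0.7 * g"
  then have "lam * alpha n c i < lam * (0.7 * g)" using lam_pos by simp
  then have "lam * alpha n c i < 70 * l" using lam_g[of "0.7"] by linarith
  then have "exp (lam * alpha n c i) < exp (70 * l)" by simp
  also have "\<dots> \<le> exp (72 * l)" by (rule exp_l_ge) simp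
  finally show ?thesis unfolding V_def by linarith
qed

lemma V_high: "0.8 * g < alpha n c i \<Longrightarrow> exp (75 * l) < V i c"
proof -
  assume "0.8 * g < alpha n c i"
  then have "lam * (0.8 * g) < lam * alpha n c i" using lam_pos by simp
  then have "80 * l < lam * alpha n c i" using lam_g[of "0.8"] by linarith
  then have "exp (80 * l) < exp (lam * alpha n c i)" by simp
  moreover have "2 * exp (75 * l) \<le> exp (80 * l)" by (rule two_exp) simp
  moreover have "1 \<le> exp (75 * l)" by (rule exp_ge_1) simp
  ultimately show ?thesis unfolding V_def by linarith
qed

lemma U_frac: "0 \<le> g * (1 / (g + alpha n c i))" "g * (1 / (g + alpha n c i)) \<le> 1"
  using g alpha_nonneg[of n c i] by auto

lemma U_low: "alpha n c i < 1.5 * g \<Longrightarrow> exp (75 * l) < RU i c"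
proof -
  assume "alpha n c i < 1.5 * g"
  then have "lam * alpha n c i < lam * (1.5 * g)" using lam_pos by simp
  then have "lam * alpha n c i < 150 * l" using lam_g[of "1.5"] by linarith
  then have "exp (- (150 * l)) < exp (- lam * alpha n c i)" by simp
  also have "\<dots> \<le> U i c" using g alpha_nonneg[of n c i] by (simp add: U_def)
  finally have "exp (230 * l) * exp (- (150 * l)) < RU i c" by (simp add: RU_def)
  moreover have "exp (230 * l) * exp (- (150 * l)) = exp (80 * l)" by (simp flip: exp_add)
  moreover have "exp (75 * l) \<le> exp (80 * l)" by (rule exp_l_ge) simp
  ultimately show ?thesis by linarith
qed

lemma U_high: "2 * g < alpha n c i \<Longrightarrow> RU i c < exp (72 * l)"
proof -
  assume "2 * g < alpha n c i"
  then have "lam * (2 * g) < lam * alpha n c i" using lam_pos by simp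
  then have "exp (- lam * alpha n c i) < exp (- (200 * l))" using lam_g[of "2"] by simp
  moreover have "exp (- 170 * l) * g * (1 / (g + alpha n c i)) \<le> exp (- 170 * l)"
    using mult_left_mono[OF U_frac(2)[of c i], of "exp (- 170 * l)"] by (simp add: mult.assoc)
  ultimately have "U i c < exp (- (200 * l)) + exp (- 170 * l)"
    unfolding U_def by (rule add_less_le_mono)
  then have "RU i c < exp (230 * l) * (exp (- (200 * l)) + exp (- 170 * l))" by (simp add: RU_def)
  \<comment> \<open>The correction in \<open>U\<close> dominates here, yet it stays below the range
    of \<open>RPhi\<close>.\<close>
  also have "\<dots> = exp (30 * l) + exp (60 * l)" by (simp add: distrib_left flip: exp_add)
  also have "\<dots> \<le> 2 * exp (60 * l)" using exp_l_ge[of 30 60] by simp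
  also have "\<dots> \<le> exp (72 * l)" by (rule two_exp) simp
  finally show ?thesis .
qed

definition W :: "nat \<Rightarrow> nat \<Rightarrow> config \<Rightarrow> real" where
  "W i j c = Min {V i c, V j c, RPhi i j c, RU i c, RU j c}"

lemma W_le: "W i j c \<le> V i c" "W i j c \<le> V j c" "W i j c \<le> RPhi i j c" "W i j c \<le> RU i c" "W i j c \<le> RU j c"
  unfolding W_def by (auto intro!: Min_le)

lemma W_cases: "W i j c = V i c \<or> W i j c = V j c \<or> W i j c = RPhi i j c \<or> W i j c = RU i c \<or> W i j c = RU j c"
proof -
  have "W i j c \<in> {V i c, V j c, RPhi i j c, RU i c, RU j c}"
    unfolding W_def by (rule Min_in) auto
  then show ?thesis by blast
qed

lemma W_nonneg: "0 \<le> W i j c"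
proof -
  have "0 \<le> V i c" for i c using lam_pos alpha_nonneg by (simp add: V_def)
  moreover have "0 \<le> RU i c" for i c using U_frac(1)[of c i] g alpha_nonneg[of n c i] by (simp add: RU_def U_def)
  moreover have "0 \<le> RPhi i j c" using RPhi_bounds(1) by (rule order_trans[rotated]) simp
  ultimately show ?thesis unfolding W_def by auto
qed

lemma W_upper: "W i j c \<le> exp (75 * l)"
  using W_le(3) RPhi_bounds(2) by (rule order_trans)

text \<open>For a living opinion \<open>V\<close> is at least \<open>lam / n\<close>.
  \<open>RU\<close> is kept large by the correction in \<open>U\<close>, even where
  \<open>exp (- lam * alpha n c i)\<close> is tiny.\<close>

lemma W_lower:
  assumes "1 / n \<le> alpha n c i" "1 / n \<le> alpha n c j"
  shows "1 / n \<le> W i j c"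
proof -
  have V: "1 / n \<le> V i c" if "1 / n \<le> alpha n c i" for i
  proof -
    have "1 \<le> lam" using l_ge_1 g_le_1 g by (simp add: lam_def pos_le_divide_eq)
    then have "1 / n \<le> lam * (1 / n)" by (simp add: divide_right_mono)
    also have "\<dots> \<le> lam * alpha n c i" using that lam_pos by (intro mult_left_mono) auto
    also have "\<dots> \<le> V i c"
      unfolding V_def using exp_ge_add_one_self[of "lam * alpha n c i"] by linarith
    finally show ?thesis .
  qed
  have U: "1 / n \<le> RU i c" for i
  proof -
    have "1 / (2 * n) \<le> g / 2" using inverse_n_le_g by simp
    also have "g / 2 \<le> g / (g + alpha n c i)"
      using g g_le_1 alpha_le_1[of n c i] alpha_nonneg[of n c i] by (intro divide_left_mono) auto
    finally have "exp (230 * l) * (exp (-170 * l) * (1 / (2 * n))) \<le> exp (230 * l) * (exp (-170 * l) * (g / (g + alpha n c i)))"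
      by (intro mult_left_mono) auto
    also have "\<dots> \<le> RU i c" unfolding RU_def U_def by (intro mult_left_mono) auto
    also have "exp (230 * l) * (exp (-170 * l) * (1 / (2 * n))) = exp (60 * l) * (1 / 2) * (1 / n)"
      by (simp add: mult.assoc[symmetric] flip: exp_add)
    finally have "exp (60 * l) * (1 / 2) * (1 / n) \<le> RU i c" .
    moreover have "1 * (1 / n) \<le> exp (60 * l) * (1 / 2) * (1 / n)"
      using two_exp[of 0 60] by (intro mult_right_mono) auto
    ultimately show ?thesis by simp
  qed
  have "1 / n \<le> 1" using inverse_n_le_g g_le_1 by linarith
  also have "1 \<le> exp (72 * l)" by (rule exp_ge_1) simp
  also have "\<dots> \<le> RPhi i j c" by (rule RPhi_bounds)
  finally show ?thesis unfolding W_def using assms by (auto simp: V U)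
qed

text \<open>Comparing the minimising potential \<open>X\<close> with the range of
  \<open>RPhi\<close>, or \<open>RPhi\<close> with the others, places the state where
  \<open>X\<close> contracts. Then \<open>W \<le> X\<close> everywhere, with equality at
  \<open>c\<close>, transfers the contraction to \<open>W\<close>.\<close>

lemma W_step:
  assumes c: "valid n k c" "band c" and i: "i \<in> {1..k}" and j: "j \<in> {1..k}" and ij: "i \<noteq> j"
  shows "E (step c) (W i j) \<le> (1 - g / 10^10) * W i j c"
proof -
  let ?q = "1 - g / 10^10"
  have red: "E (step c) (W i j) \<le> E (step c) X" if "\<And>c. W i j c \<le> X c" for X
    using that by (intro E_mono finite_step)
  have RUs: "E (step c) (RU i) \<le> ?q * RU i c" if "i \<in> {1..k}" "1.5 * g \<le> alpha n c i" for i
    using mult_left_mono[OF U_step[OF c that], of "exp (230 * l)"] by (simp add: RU_def[abs_def] mult_ac)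
  have RPhis: "E (step c) (RPhi i j) \<le> ?q * RPhi i j c"
    if "0.7 * g \<le> alpha n c i" "alpha n c i \<le> 2 * g" "0.7 * g \<le> alpha n c j" "alpha n c j \<le> 2 * g"
    using mult_left_mono[OF Phi_step[OF c i j ij that], of "exp (75 * l)"] by (simp add: RPhi_def[abs_def] mult_ac)
  note W = W_le[of i j c] RPhi_bounds[where i=i and j=j and c=c]
  consider "W i j c = V i c" | "W i j c = V j c" | "W i j c = RPhi i j c" | "W i j c = RU i c" | "W i j c = RU j c"
    using W_cases[of i j c] by blast
  then show ?thesis
  proof cases
    case 1
    then have "alpha n c i \<le> 0.8 * g" using V_high[of c i] W by linarith
    then show ?thesis using V_step[OF c i] red[of "V i", OF W_le(1)] 1 by simp
  next
    case 2
    then have "alpha n c j \<le> 0.8 * g" using V_high[of c j] W by linarith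
    then show ?thesis using V_step[OF c j] red[of "V j", OF W_le(2)] 2 by simp
  next
    case 3
    have "0.7 * g \<le> alpha n c i" using 3 V_low[of c i] W by linarith
    moreover have "0.7 * g \<le> alpha n c j" using 3 V_low[of c j] W by linarith
    moreover have "alpha n c i \<le> 2 * g" using 3 U_high[of c i] W by linarith
    moreover have "alpha n c j \<le> 2 * g" using 3 U_high[of c j] W by linarith
    ultimately show ?thesis using RPhis red[of "RPhi i j", OF W_le(3)] 3 by simp
  next
    case 4
    then have "1.5 * g \<le> alpha n c i" using U_low[of c i] W by linarith
    then show ?thesis using RUs[OF i] red[of "RU i", OF W_le(4)] 4 by simp
  next
    case 5
    then have "1.5 * g \<le> alpha n c j" using U_low[of c j] W by linarith
    then show ?thesis using RUs[OF j] red[of "RU j", OF W_le(5)] 5 by simp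
  qed
qed

section \<open>All pairs together, and the length of a phase\<close>

text \<open>The factor \<open>n\<close> lifts the lower bound \<open>1 / n\<close> of
  \<open>W\<close> to the 1 that \<open>nohit_potential\<close> requires outside consensus.\<close>

definition Wsum :: "config \<Rightarrow> real" where
  "Wsum c = n * (\<Sum>i\<in>{1..k}. \<Sum>j\<in>{1..k} - {i}. W i j c)"

lemma Wsum_nonneg: "0 \<le> Wsum c"
  unfolding Wsum_def by (intro mult_nonneg_nonneg sum_nonneg W_nonneg) auto

lemma Wsum_ge_1:
  assumes "valid n k c" "\<not> is_consensus n k c"
  shows "1 \<le> Wsum c"
proof -
  obtain i j where ij: "i \<in> {1..k}" "j \<in> {1..k}" "i \<noteq> j" "1 / n \<le> alpha n c i" "1 / n \<le> alpha n c j"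
    using not_consensusE[OF assms(1) n_pos(2) assms(2)] .
  have "1 / n \<le> W i j c" using ij by (intro W_lower)
  also have "\<dots> \<le> (\<Sum>j\<in>{1..k} - {i}. W i j c)"
    using ij by (intro member_le_sum W_nonneg) auto
  also have "\<dots> \<le> (\<Sum>i\<in>{1..k}. \<Sum>j\<in>{1..k} - {i}. W i j c)"
    using ij by (intro member_le_sum[of i "{1..k}" "\<lambda>i. \<Sum>j\<in>{1..k} - {i}. W i j c"] sum_nonneg W_nonneg) auto
  finally show ?thesis using n_pos by (simp add: Wsum_def field_simps)
qed

lemma Wsum_le: "Wsum c \<le> exp (78 * l)"
proof -
  have "(\<Sum>j\<in>{1..k} - {i}. W i j c) \<le> k * exp (75 * l)" for i
  proof -
    have "(\<Sum>j\<in>{1..k} - {i}. W i j c) \<le> (\<Sum>j\<in>{1..k}. W i j c)"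
      by (rule sum_mono2) (auto simp: W_nonneg)
    also have "\<dots> \<le> (\<Sum>j\<in>{1..k}. exp (75 * l))" by (intro sum_mono W_upper)
    finally show ?thesis by simp
  qed
  then have "(\<Sum>i\<in>{1..k}. \<Sum>j\<in>{1..k} - {i}. W i j c) \<le> (\<Sum>i\<in>{1..k}. k * exp (75 * l))"
    by (intro sum_mono)
  also have "\<dots> = k * (k * exp (75 * l))" by simp
  also have "\<dots> \<le> n * (n * exp (75 * l))" using k by (intro mult_mono) auto
  finally have "Wsum c \<le> n * (n * (n * exp (75 * l)))"
    unfolding Wsum_def by (intro mult_left_mono) auto
  also have "\<dots> = exp (78 * l)" by (simp add: exp_l[symmetric] flip: exp_add)
  finally show ?thesis .
qed

lemma Wsum_step:
  assumes c: "valid n k c" "band c"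
  shows "E (step c) Wsum \<le> (1 - g / 10^10) * Wsum c"
proof -
  have "E (step c) Wsum = n * (\<Sum>i\<in>{1..k}. \<Sum>j\<in>{1..k} - {i}. E (step c) (W i j))"
    unfolding Wsum_def by (simp add: E_sum[OF finite_step])
  also have "\<dots> \<le> n * (\<Sum>i\<in>{1..k}. \<Sum>j\<in>{1..k} - {i}. (1 - g / 10^10) * W i j c)"
    using c by (intro mult_left_mono sum_mono W_step) auto
  also have "\<dots> = (1 - g / 10^10) * Wsum c"
    by (simp add: Wsum_def sum_distrib_left mult.left_commute)
  finally show ?thesis .
qed

text \<open>Over \<open>82 * 10^10 * l / g\<close> rounds, the contraction by about
  \<open>exp (- 82 * l)\<close> beats \<open>Wsum \<le> exp (78 * l)\<close>, while the growth of
  \<open>G\<close> by \<open>exp (82 * l)\<close> loses to its initial value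
  \<open>exp (- 85 * l)\<close>. Each part contributes at most \<open>exp (- 3 * l)\<close>.\<close>

lemma phase_bound:
  assumes c: "valid n k c" and gc: "gamma n k c = g"
  shows "nohit (\<lambda>c. is_consensus n k c \<or> 1.2 * g \<le> gamma n k c) step (nat \<lfloor>82 * 10^10 * l / g\<rfloor>) c
    \<le> 1 / n^2"
proof -
  define X where "X = 82 * 10^10 * l / g"
  define T where "T = nat \<lfloor>X\<rfloor>"
  \<comment> \<open>Normalised to equal 1 at the lower edge \<open>0.95 * g\<close> of the
    band.\<close>
  define G where "G = (\<lambda>c. exp (lam2 * (0.95 * g)) * exp (- lam2 * gamma n k c))"
  have Tpos: "0 \<le> X" using l_ge_1 g by (simp add: X_def)
  then have T1: "T \<le> X" by (simp add: T_def)
  have T2: "X - 1 \<le> T" unfolding T_def using Tpos by linarith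
  have Xg: "X * (g / 10^10) = 82 * l" using g by (simp add: X_def)
  have bound: "nohit (\<lambda>c. is_consensus n k c \<or> 1.2 * g \<le> gamma n k c) step T c
    \<le> (exp (g / 10^10)) ^ T * G c + (1 - g / 10^10) ^ T * Wsum c"
  proof (rule nohit_potential[where I = "valid n k" and B = "\<lambda>c. 0.95 * g \<le> gamma n k c"])
    fix c
    assume v: "valid n k c" and nA: "\<not> (is_consensus n k c \<or> 1.2 * g \<le> gamma n k c)"
    show "1 \<le> G c" if "\<not> 0.95 * g \<le> gamma n k c"
    proof -
      have "0 \<le> lam2 * (0.95 * g - gamma n k c)" using that lam2_pos by simp
      then have "1 \<le> exp (lam2 * (0.95 * g - gamma n k c))" by simp
      also have "\<dots> = G c" by (simp add: G_def algebra_simps flip: exp_add)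
      finally show ?thesis .
    qed
    show "E (step c) G \<le> exp (g / 10^10) * G c" if "0.95 * g \<le> gamma n k c"
      using mult_left_mono[OF exp_gamma_step[OF v], of "exp (lam2 * (0.95 * g))"] nA
      by (simp add: G_def mult_ac)
    show "1 \<le> Wsum c" using Wsum_ge_1[OF v] nA by simp
    show "E (step c) Wsum \<le> (1 - g / 10^10) * Wsum c" if "0.95 * g \<le> gamma n k c"
      using Wsum_step[OF v] that nA by (simp add: band_def)
  qed (use c g g_le_1 in \<open>auto simp: G_def Wsum_nonneg finite_step dest: valid_step\<close>)
  have "(exp (g / 10^10)) ^ T * G c = exp (T * (g / 10^10)) * exp (- (lam2 * (0.05 * g)))"
    by (simp add: G_def gc exp_of_nat_mult[symmetric] algebra_simps flip: exp_add)
  also have "lam2 * (0.05 * g) = 85 * l" using g by (simp add: lam2_def)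
  also have "T * (g / 10^10) \<le> X * (g / 10^10)"
    using T1 g by (intro mult_right_mono) auto
  also have "\<dots> = 82 * l" by (rule Xg)
  also have "exp (82 * l) * exp (- (85 * l)) = exp (- 3 * l)" by (simp flip: exp_add)
  finally have A: "(exp (g / 10^10)) ^ T * G c \<le> exp (- 3 * l)" by simp
  have "(1 - g / 10^10) ^ T \<le> exp (- (g / 10^10)) ^ T"
    using g_le_1 exp_ge_add_one_self[of "- (g / 10^10)"] by (intro power_mono) auto
  also have "\<dots> = exp (- (T * (g / 10^10)))" by (simp add: exp_of_nat_mult[symmetric])
  \<comment> \<open>Rounding the number of rounds down costs at most a factor
    \<open>exp 1\<close>.\<close>
  also have "\<dots> \<le> exp (1 - 82 * l)"
  proof -
    have "(X - 1) * (g / 10^10) \<le> T * (g / 10^10)"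
      using T2 g by (intro mult_right_mono) auto
    moreover have "(X - 1) * (g / 10^10) = 82 * l - g / 10^10"
      by (simp only: left_diff_distrib Xg mult_1)
    moreover have "g / 10^10 \<le> 1" using g_le_1 by simp
    ultimately show ?thesis unfolding exp_le_cancel_iff by linarith
  qed
  finally have "(1 - g / 10^10) ^ T * Wsum c \<le> exp (1 - 82 * l) * exp (78 * l)"
    by (intro mult_mono Wsum_le Wsum_nonneg) auto
  also have "\<dots> \<le> exp (- 3 * l)" using l_ge_1 by (simp flip: exp_add)
  finally have "nohit (\<lambda>c. is_consensus n k c \<or> 1.2 * g \<le> gamma n k c) step T c \<le> 2 * exp (- 3 * l)"
    using bound A by simp
  also have "\<dots> \<le> exp (- 2 * l)" by (rule two_exp) simp
  also have "exp (- 2 * l) = 1 / n^2"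
    by (simp add: exp_l[symmetric] exp_minus power2_eq_square inverse_eq_divide flip: exp_add)
  finally show ?thesis unfolding T_def X_def .
qed

end

section \<open>Composition of the phases\<close>

text \<open>The phase lengths \<open>M / g\<close> decrease geometrically as \<open>gamma\<close>
  grows by factors \<open>6/5\<close>, so they sum to at most \<open>6 * M / g\<close>, and
  \<open>492 = 6 * 82\<close>. The induction is over a bound \<open>m\<close> on the phases left,
  each failing with probability at most \<open>1 / n^2\<close>.\<close>

lemma nohit_consensus:
  fixes thr :: real and w :: "real \<Rightarrow> real"
  assumes ph: "\<And>g. thr \<le> g \<Longrightarrow> g \<le> 1 \<Longrightarrow> phase n k rule g (w g)"
    and n: "n > 0" and c: "valid n k c" and thr: "thr \<le> gamma n k c" "0 < thr"
  shows "nohit (is_consensus n k) (sync_step n rule) (nat \<lfloor>492 * 10^10 * ln n / gamma n k c\<rfloor>) c \<le> 5 / n"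
proof -
  define M :: real where "M = 82 * 10^10 * ln n"
  define T where "T = (\<lambda>g. nat \<lfloor>6 * M / g\<rfloor>)"
  let ?S = "sync_step n rule" and ?P = "is_consensus n k"
  have M0: "0 \<le> M" using n by (simp add: M_def)
  have phc: "phase n k rule (gamma n k c) (w (gamma n k c))" if "valid n k c" "thr \<le> gamma n k c" for c
    using that gamma_le_1 n by (intro ph) auto
  have fin: "finite (set_pmf (?S c'))" for c'
    using phase.finite_step[OF phc[OF c thr(1)]] .
  have inv: "valid n k c''" if "valid n k c'" "c'' \<in> set_pmf (?S c')" for c' c''
    using phase.valid_step[OF phc[OF c thr(1)] that] .
  note nohit = nohit_antimono[where I = "valid n k" and S = ?S, OF fin inv]
    nohit_restart[where I = "valid n k" and S = ?S, OF fin inv]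
  have main: "nohit ?P ?S (T (gamma n k c)) c \<le> m / n^2"
    if "valid n k c" "thr \<le> gamma n k c" "1 < gamma n k c * (6/5)^m" for m c
    using that
  proof (induction m arbitrary: c)
    \<comment> \<open>With no phases left \<open>gamma n k c\<close> would exceed 1.\<close>
    case 0
    then show ?case using gamma_le_1[of n k c] n by auto
  next
    case (Suc m)
    define g where "g = gamma n k c"
    define A where "A = (\<lambda>c. ?P c \<or> 6/5 * g \<le> gamma n k c)"
    have g: "g > 0" using Suc.prems thr by (simp add: g_def)
    \<comment> \<open>The time budget reproduces itself after one phase, and since floors are
      superadditive the rounding does no harm.\<close>
    have "6 * M / g = M / g + 6 * M / (6/5 * g)" using g by (simp add: field_simps)
    then have "\<lfloor>M / g\<rfloor> + \<lfloor>6 * M / (6/5 * g)\<rfloor> \<le> \<lfloor>6 * M / g\<rfloor>"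
      using le_floor_add[of "M / g" "6 * M / (6/5 * g)"] by simp
    moreover have "0 \<le> \<lfloor>M / g\<rfloor>" "0 \<le> \<lfloor>6 * M / (6/5 * g)\<rfloor>" using M0 g by auto
    ultimately have "nat \<lfloor>M / g\<rfloor> + T (6/5 * g) \<le> T g" unfolding T_def by linarith
    then have "nohit ?P ?S (T g) c \<le> nohit ?P ?S (nat \<lfloor>M / g\<rfloor> + T (6/5 * g)) c"
      by (intro nohit(1) Suc.prems)
    also have "\<dots> \<le> nohit A ?S (nat \<lfloor>M / g\<rfloor>) c + m / n^2"
    proof (rule nohit(2))
      fix c' assume v: "valid n k c'" and "A c'"
      show "nohit ?P ?S (T (6/5 * g)) c' \<le> m / n^2"
      proof (cases "?P c'")
        case True
        then show ?thesis by (cases "T (6/5 * g)") auto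
      next
        case False
        then have g': "6/5 * g \<le> gamma n k c'" using \<open>A c'\<close> by (simp add: A_def)
        have "6 * M / gamma n k c' \<le> 6 * M / (6/5 * g)"
          using g g' M0 by (intro divide_left_mono) auto
        then have "T (gamma n k c') \<le> T (6/5 * g)" unfolding T_def by (intro nat_mono floor_mono)
        then have "nohit ?P ?S (T (6/5 * g)) c' \<le> nohit ?P ?S (T (gamma n k c')) c'"
          by (intro nohit(1) v)
        also have "\<dots> \<le> m / n^2"
        proof (rule Suc.IH[OF v])
          show "thr \<le> gamma n k c'" using g' Suc.prems(2) g by (simp add: g_def)
          have "1 < (6/5 * g) * (6/5)^m" using Suc.prems(3) by (simp add: g_def mult_ac)
          also have "\<dots> \<le> gamma n k c' * (6/5)^m" using g' by (intro mult_right_mono) auto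
          finally show "1 < gamma n k c' * (6/5)^m" .
        qed
        finally show ?thesis .
      qed
    qed (use Suc.prems in \<open>auto simp: A_def\<close>)
    also have "nohit A ?S (nat \<lfloor>M / g\<rfloor>) c \<le> 1 / n^2"
      using phase.phase_bound[OF phc[OF Suc.prems(1,2)] Suc.prems(1) refl]
      by (simp add: A_def M_def g_def phase.l_def[OF phc[OF Suc.prems(1,2)]])
    finally show ?case by (simp add: g_def add_divide_distrib)
  qed
  \<comment> \<open>A crude count of \<open>5 * n\<close> phases suffices:
    \<open>gamma n k c \<ge> 1 / n\<close> and \<open>(6/5)^(5 * n) \<ge> 1 + n\<close>. The
    failures then add up to \<open>5 / n\<close>.\<close>
  have "1 / n * (1 + real (5 * n) * (1/5)) \<le> gamma n k c * (1 + 1/5)^(5 * n)"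
  proof (rule mult_mono)
    show "1 / n \<le> gamma n k c" by (rule phase.inverse_n_le_g[OF phc[OF c thr(1)]])
    show "1 + real (5 * n) * (1/5) \<le> (1 + 1/5)^(5 * n)" by (rule Bernoulli_inequality) simp
  qed (use gamma_nonneg in auto)
  moreover have "1 / n * (1 + real (5 * n) * (1/5)) > 1" using n by (simp add: field_simps)
  ultimately have "1 < gamma n k c * (6/5)^(5 * n)" by simp
  from main[OF c thr(1) this] have "nohit ?P ?S (T (gamma n k c)) c \<le> 5 / n"
    using n by (simp add: power2_eq_square)
  then show ?thesis by (simp add: T_def M_def)
qed

lemma prob_cons_by_ge:
  assumes ph: "\<And>g. thr \<le> g \<Longrightarrow> g \<le> 1 \<Longrightarrow> phase n k rule g (w g)"
    and n: "n > 0" and fin: "\<And>c v. finite (set_pmf (rule n c v))"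
    and c: "valid n k c" and thr: "thr \<le> gamma n k c" "0 < thr"
  shows "1 - 5 * real n powr (- 1) \<le> prob_cons_by n k rule c (nat \<lfloor>492 * 10^10 * ln n / gamma n k c\<rfloor>)"
proof -
  have "finite (set_pmf (sync_step n rule c'))" for c'
    unfolding sync_step_def using fin by (intro finite_set_Pi_pmf) auto
  from prob_cons_by_eq[OF this] nohit_consensus[OF ph n c thr] show ?thesis
    using n by (simp add: powr_minus_divide)
qed

section \<open>One-round laws of the two rules\<close>

context
  fixes n :: nat
  assumes n: "n > 0"
begin

lemma vertices_nonempty: "{..<n} \<noteq> {}"
  using n by auto

lemma set_unif: "set_pmf (unif_vertex n) = {..<n}"
  unfolding unif_vertex_def by (rule set_pmf_of_set[OF vertices_nonempty]) simp

lemma finite_unif: "finite (set_pmf (unif_vertex n))"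
  by (simp add: set_unif)

lemma E_unif_vertex: "E (unif_vertex n) f = (\<Sum>v<n. f v) / n"
  unfolding unif_vertex_def by (simp add: integral_pmf_of_set[OF vertices_nonempty])

lemma finite_three_maj: "finite (set_pmf (three_maj_vertex n c' v))"
  using n by (simp add: three_maj_vertex_def finite_unif)

lemma finite_two_choices: "finite (set_pmf (two_choices_vertex n c' v))"
  using n by (simp add: two_choices_vertex_def finite_unif)

end

context
  fixes n k :: nat and c :: config
  assumes n: "n > 0" and c: "valid n k c"
begin

lemma E_unif: "E (unif_vertex n) (\<lambda>w. h (c w)) = (\<Sum>i\<in>{1..k}. alpha n c i * h i)"
  unfolding E_unif_vertex[OF n] sum_alpha_mult[OF c] ..

lemma alpha_sq_le_gamma: "i \<in> {1..k} \<Longrightarrow> (alpha n c i)^2 \<le> gamma n k c"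
  unfolding gamma_def by (rule member_le_sum) auto

text \<open>Two samples disagree with probability \<open>1 - gamma n k c\<close>, and
  \<open>b\<close> is then the chance of \<open>i\<close>: it is \<open>alpha n c i\<close> for the
  third sample of 3-Majority and \<open>of_bool (c v = i)\<close> for 2-Choices.\<close>

lemma two_sample_sum:
  fixes b :: real
  assumes i: "i \<in> {1..k}"
  shows "(\<Sum>x\<in>{1..k}. alpha n c x * (\<Sum>y\<in>{1..k}. alpha n c y * (if x = y then of_bool (x = i) else b))) = (alpha n c i)^2 + b * (1 - gamma n k c)"
proof -
  have "(\<Sum>y\<in>{1..k}. alpha n c y * (if x = y then of_bool (x = i) else b)) = alpha n c x * (of_bool (x = i) - b) + b"
    if x: "x \<in> {1..k}" for x
  proof -
    have "(\<Sum>y\<in>{1..k}. alpha n c y * (if x = y then of_bool (x = i) else b))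
       = (\<Sum>y\<in>{1..k}. (if y = x then alpha n c x * (of_bool (x = i) - b) else 0) + alpha n c y * b)"
      by (rule sum.cong) (auto simp: algebra_simps)
    also have "\<dots> = alpha n c x * (of_bool (x = i) - b) + (\<Sum>y\<in>{1..k}. alpha n c y) * b"
      using x by (simp add: sum.distrib sum_distrib_right del: One_nat_def)
    finally show ?thesis using sum_alpha[OF c n] by simp
  qed
  then have "(\<Sum>x\<in>{1..k}. alpha n c x * (\<Sum>y\<in>{1..k}. alpha n c y * (if x = y then of_bool (x = i) else b)))
     = (\<Sum>x\<in>{1..k}. alpha n c x * (alpha n c x * (of_bool (x = i) - b) + b))"
    by (intro sum.cong) auto
  also have "\<dots> = (\<Sum>x\<in>{1..k}. (if x = i then (alpha n c i)^2 else 0) - b * (alpha n c x)^2 + alpha n c x * b)"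
    by (rule sum.cong) (auto simp: algebra_simps power2_eq_square)
  also have "\<dots> = (alpha n c i)^2 - b * gamma n k c + (\<Sum>x\<in>{1..k}. alpha n c x) * b"
    using i by (simp add: sum.distrib sum_subtractf sum_distrib_left sum_distrib_right gamma_def del: One_nat_def)
  finally show ?thesis using sum_alpha[OF c n] by (simp add: algebra_simps)
qed

lemma set_three_maj: "set_pmf (three_maj_vertex n c v) \<subseteq> {1..k}"
  using c by (auto simp: three_maj_vertex_def set_unif[OF n] valid_def)

lemma set_two_choices: "v < n \<Longrightarrow> set_pmf (two_choices_vertex n c v) \<subseteq> {1..k}"
  using c by (auto simp: two_choices_vertex_def set_unif[OF n] valid_def)

lemma pmf_three_maj:
  assumes i: "i \<in> {1..k}"
  shows "pmf (three_maj_vertex n c v) i = alpha n c i * (1 + alpha n c i - gamma n k c)"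
proof -
  have "pmf (three_maj_vertex n c v) i = E (unif_vertex n) (\<lambda>u. E (unif_vertex n) (\<lambda>w. E (unif_vertex n)
      (\<lambda>z. of_bool ((if c u = c w then c u else c z) = i))))"
    unfolding E_of_bool[symmetric] three_maj_vertex_def by (simp add: E_pair finite_unif[OF n])
  also have "\<dots> = E (unif_vertex n) (\<lambda>u. E (unif_vertex n) (\<lambda>w. if c u = c w then of_bool (c u = i) else alpha n c i))"
  proof -
    have "E (unif_vertex n) (\<lambda>z. of_bool (c z = i)) = alpha n c i"
      unfolding E_unif_vertex[OF n] alpha_eq_sum ..
    then have "E (unif_vertex n) (\<lambda>z. of_bool ((if c u = c w then c u else c z) = i))
       = (if c u = c w then of_bool (c u = i) else alpha n c i)" for u w by auto
    then show ?thesis by presburger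
  qed
  also have "\<dots> = (\<Sum>x\<in>{1..k}. alpha n c x * (\<Sum>y\<in>{1..k}. alpha n c y * (if x = y then of_bool (x = i) else alpha n c i)))"
    by (simp only: E_unif[of "\<lambda>y. if x = y then of_bool (x = i) else alpha n c i" for x]
        E_unif[of "\<lambda>x. \<Sum>y\<in>{1..k}. alpha n c y * (if x = y then of_bool (x = i) else alpha n c i)"])
  also have "\<dots> = (alpha n c i)^2 + alpha n c i * (1 - gamma n k c)" by (rule two_sample_sum[OF i])
  finally show ?thesis by (simp add: power2_eq_square algebra_simps)
qed

lemma pmf_two_choices:
  assumes i: "i \<in> {1..k}"
  shows "pmf (two_choices_vertex n c v) i = (alpha n c i)^2 + of_bool (c v = i) * (1 - gamma n k c)"
proof -
  have "pmf (two_choices_vertex n c v) i = E (unif_vertex n) (\<lambda>u. E (unif_vertex n)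
      (\<lambda>w. of_bool ((if c u = c w then c u else c v) = i)))"
    unfolding E_of_bool[symmetric] two_choices_vertex_def by (simp add: E_pair finite_unif[OF n])
  also have "\<dots> = E (unif_vertex n) (\<lambda>u. E (unif_vertex n) (\<lambda>w. if c u = c w then of_bool (c u = i) else of_bool (c v = i)))"
    by (simp add: if_distrib[of "\<lambda>x. x = i"] if_distrib[of of_bool])
  also have "\<dots> = (\<Sum>x\<in>{1..k}. alpha n c x * (\<Sum>y\<in>{1..k}. alpha n c y * (if x = y then of_bool (x = i) else of_bool (c v = i))))"
    by (simp only: E_unif[of "\<lambda>y. if x = y then of_bool (x = i) else of_bool (c v = i)" for x]
        E_unif[of "\<lambda>x. \<Sum>y\<in>{1..k}. alpha n c y * (if x = y then of_bool (x = i) else of_bool (c v = i))"])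
  also have "\<dots> = (alpha n c i)^2 + of_bool (c v = i) * (1 - gamma n k c)" by (rule two_sample_sum[OF i])
  finally show ?thesis .
qed

lemma alpha_pair_le_1: "i \<in> {1..k} \<Longrightarrow> j \<in> {1..k} \<Longrightarrow> i \<noteq> j \<Longrightarrow> alpha n c i + alpha n c j \<le> 1"
proof -
  assume ij: "i \<in> {1..k}" "j \<in> {1..k}" "i \<noteq> j"
  then have "alpha n c i + alpha n c j = (\<Sum>x\<in>{i, j}. alpha n c x)" by simp
  also have "\<dots> \<le> (\<Sum>x\<in>{1..k}. alpha n c x)" using ij by (intro sum_mono2) (auto simp: alpha_nonneg)
  finally show ?thesis using sum_alpha[OF c n] by simp
qed

text \<open>Two such opinions force \<open>1.4 * g \<le> 1\<close>, hence
  \<open>1.2 * g \<le> 6/7\<close>. This keeps \<open>1 - gamma n k c\<close> away from 0 in the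
  lower variance bounds.\<close>

lemma gamma_le_6_7:
  assumes "gamma n k c \<le> 1.2 * g" "i \<in> {1..k}" "j \<in> {1..k}" "i \<noteq> j" "0.7 * g \<le> alpha n c i" "0.7 * g \<le> alpha n c j"
  shows "gamma n k c \<le> 6/7"
  using assms alpha_pair_le_1[OF assms(2-4)] by simp

end

section \<open>Both rules satisfy the assumptions of a phase\<close>

lemma phase_three_maj:
  assumes n: "real n \<ge> 2 * 10^6" and k: "k \<le> n" and g: "0 < g" "g \<le> 1"
    and large: "10^18 * (ln n)^2 \<le> n * g^2"
  shows "phase n k three_maj_vertex g 1"
proof
  have n0: "n > 0" using n by (auto intro: Nat.gr0I)
  note pmf = pmf_three_maj[OF n0]
  show "2 * 10^6 \<le> real n" by (rule n)
  show "k \<le> n" by (rule k)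
  show "0 < g" "g \<le> 1" "(1::real) \<le> 1" using g by auto
  show "10^18 * (ln n)^2 * 1 \<le> n * g^2" using large by (simp only: mult_1_right)
  show "finite (set_pmf (three_maj_vertex n c v))" for c v by (rule finite_three_maj[OF n0])
  fix c i
  assume c: "valid n k c"
  let ?a = "alpha n c" and ?G = "gamma n k c"
  note G0 = gamma_nonneg[of n k c] and G1 = gamma_le_1[OF c n0]
  show "set_pmf (three_maj_vertex n c v) \<subseteq> {1..k}" for v by (rule set_three_maj[OF n0 c])
  have p2: "?a i * (1 + ?a i - ?G) \<le> 2 * ?a i" for i
    using mult_left_mono[of "1 + ?a i - ?G" 2 "?a i"] alpha_nonneg[of n c i] alpha_le_1[of n c i] G0
    by (simp add: mult.commute)
  show "(\<Sum>v<n. Var (three_maj_vertex n c v) ?a) \<le> 3 * n * g * 1" if G: "?G \<le> 1.2 * g"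
  proof -
    have "Var (three_maj_vertex n c v) ?a \<le> 3 * g" for v
    proof -
      have "Var (three_maj_vertex n c v) ?a \<le> E (three_maj_vertex n c v) (\<lambda>z. (?a z)^2)"
        using Var_le[OF finite_three_maj[OF n0], where x = 0] by simp
      also have "\<dots> = (\<Sum>i\<in>{1..k}. (?a i)^2 * pmf (three_maj_vertex n c v) i)"
        using set_three_maj[OF n0 c, of v] by (intro integral_measure_pmf_real) auto
      also have "\<dots> \<le> (\<Sum>i\<in>{1..k}. (?a i)^2 * 2)"
      proof (intro sum_mono mult_left_mono)
        fix i assume "i \<in> {1..k}"
        then show "pmf (three_maj_vertex n c v) i \<le> 2" using pmf_le_1[of "three_maj_vertex n c v" i] by linarith
      qed auto
      also have "\<dots> = 2 * ?G" by (simp add: gamma_def sum_distrib_right[symmetric])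
      also have "\<dots> \<le> 3 * g" using G g by simp
      finally show ?thesis .
    qed
    then have "(\<Sum>v<n. Var (three_maj_vertex n c v) ?a) \<le> (\<Sum>v<n. 3 * g)" by (intro sum_mono)
    then show ?thesis by simp
  qed
  assume i: "i \<in> {1..k}"
  show "(\<Sum>v<n. pmf (three_maj_vertex n c v) i) = n * ?a i * (1 + ?a i - ?G)"
    by (simp add: pmf[OF c i])
  define p where "p = ?a i * (1 + ?a i - ?G)"
  have sum_eq: "(\<Sum>v<n. pmf (three_maj_vertex n c v) i * (1 - pmf (three_maj_vertex n c v) i)) = n * (p * (1 - p))"
    by (simp add: pmf[OF c i] p_def)
  have p0: "0 \<le> p" using G1 alpha_nonneg[of n c i] by (simp add: p_def)
  show "(\<Sum>v<n. pmf (three_maj_vertex n c v) i * (1 - pmf (three_maj_vertex n c v) i))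
      \<le> 3 * n * ?a i * (1 + ?a i)"
  proof -
    have "p * (1 - p) \<le> p" using p0 by (simp add: algebra_simps)
    also have "p \<le> 3 * ?a i * 1" using p2[of i] alpha_nonneg[of n c i] by (simp add: p_def)
    also have "\<dots> \<le> 3 * ?a i * (1 + ?a i)" using alpha_nonneg[of n c i] by (intro mult_left_mono) auto
    finally have "n * (p * (1 - p)) \<le> n * (3 * ?a i * (1 + ?a i))" by (intro mult_left_mono) auto
    then show ?thesis unfolding sum_eq by (simp add: mult_ac)
  qed
  fix j
  assume G: "?G \<le> 1.2 * g" and j: "j \<in> {1..k}" and ij: "i \<noteq> j"
    and ai: "0.7 * g \<le> ?a i" "?a i \<le> 2 * g" and aj: "0.7 * g \<le> ?a j"
  have G6: "?G \<le> 6/7" using gamma_le_6_7[OF n0 c G i j ij ai(1) aj] .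
  have low: "g / 10 \<le> ?a m * (1 + ?a m - ?G)" if "0.7 * g \<le> ?a m" for m
  proof -
    have "g / 10 = (0.7 * g) * (1/7)" by simp
    also have "\<dots> \<le> ?a m * (1 + ?a m - ?G)"
      using that g G6 alpha_nonneg[of n c m] by (intro mult_mono) auto
    finally show ?thesis .
  qed
  \<comment> \<open>For small \<open>g\<close> both factors of \<open>p\<close> are small enough.
    For large \<open>g\<close> the opinion \<open>j\<close> itself takes probability at least
    \<open>g / 10\<close>.\<close>
  have "1 / 40 \<le> 1 - p"
  proof (cases "g \<le> 1/4")
    case True
    have "p \<le> (1/2) * (3/2)" unfolding p_def using ai True G0 g G1 by (intro mult_mono) auto
    then show ?thesis by simp
  next
    case False
    have "p + ?a j * (1 + ?a j - ?G) = measure_pmf.prob (three_maj_vertex n c 0) {i, j}"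
      using ij by (simp add: measure_measure_pmf_finite pmf[OF c i] pmf[OF c j] p_def)
    then have "p + ?a j * (1 + ?a j - ?G) \<le> 1" by simp
    then show ?thesis using low[OF aj] False by simp
  qed
  then have "(g / 10) * (1 / 40) \<le> p * (1 - p)"
    using low[OF ai(1)] g p0 by (intro mult_mono) (auto simp: p_def)
  then have "n * ((g / 10) * (1 / 40)) \<le> n * (p * (1 - p))" by (intro mult_left_mono) auto
  then show "n * g * 1 / 400 \<le> (\<Sum>v<n. pmf (three_maj_vertex n c v) i * (1 - pmf (three_maj_vertex n c v) i))"
    unfolding sum_eq by simp
qed

lemma phase_two_choices:
  assumes n: "real n \<ge> 2 * 10^6" and k: "k \<le> n" and g: "0 < g" "g \<le> 1"
    and large: "10^18 * (ln n)^2 \<le> n * g"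
  shows "phase n k two_choices_vertex g g"
proof
  have n0: "n > 0" using n by (auto intro: Nat.gr0I)
  note pmf = pmf_two_choices[OF n0]
  show "2 * 10^6 \<le> real n" by (rule n)
  show "k \<le> n" by (rule k)
  show "0 < g" "g \<le> g" "g \<le> 1" using g by auto
  show "10^18 * (ln n)^2 * g \<le> n * g^2"
    using mult_right_mono[OF large, of g] g by (simp only: power2_eq_square mult.assoc)
  show "finite (set_pmf (two_choices_vertex n c v))" for c v by (rule finite_two_choices[OF n0])
  fix c i
  assume c: "valid n k c"
  let ?a = "alpha n c" and ?G = "gamma n k c"
  note G0 = gamma_nonneg[of n k c] and G1 = gamma_le_1[OF c n0]
  show "set_pmf (two_choices_vertex n c v) \<subseteq> {1..k}" if "v < n" for v by (rule set_two_choices[OF n0 c that])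
  show "(\<Sum>v<n. Var (two_choices_vertex n c v) ?a) \<le> 3 * n * g * g" if G: "?G \<le> 1.2 * g"
  proof -
    have "Var (two_choices_vertex n c v) ?a \<le> 3 * g * g" if v: "v < n" for v
    proof -
      have cv: "c v \<in> {1..k}" using c v by (auto simp: valid_def)
      \<comment> \<open>Centred at the vertex's own value, keeping the opinion contributes nothing;
        this gains a factor \<open>g\<close> over 3-Majority.\<close>
      have "Var (two_choices_vertex n c v) ?a \<le> E (two_choices_vertex n c v) (\<lambda>z. (?a z - ?a (c v))^2)"
        by (rule Var_le[OF finite_two_choices[OF n0]])
      also have "\<dots> = (\<Sum>i\<in>{1..k}. (?a i - ?a (c v))^2 * pmf (two_choices_vertex n c v) i)"
        using set_two_choices[OF n0 c v] by (intro integral_measure_pmf_real) auto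
      \<comment> \<open>The law differs from \<open>(?a i)^2\<close> only at \<open>i = c v\<close>,
        where the first factor is zero.\<close>
      also have "\<dots> = (\<Sum>i\<in>{1..k}. (?a i - ?a (c v))^2 * (?a i)^2)"
        by (intro sum.cong refl) (auto simp: pmf[OF c])
      also have "\<dots> \<le> (\<Sum>i\<in>{1..k}. ?G * (?a i)^2)"
      proof (intro sum_mono mult_right_mono)
        fix i assume i: "i \<in> {1..k}"
        have "(x - y)^2 \<le> x^2 + y^2" if "0 \<le> x" "0 \<le> y" for x y :: real
          using mult_nonneg_nonneg[OF that] by (simp add: power2_eq_square algebra_simps)
        moreover have "\<bar>x - y\<bar> \<le> max x y" if "0 \<le> x" "0 \<le> y" for x y :: real using that by auto
        ultimately have "\<bar>?a i - ?a (c v)\<bar> \<le> max (?a i) (?a (c v))" using alpha_nonneg by blast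
        then have "\<bar>?a i - ?a (c v)\<bar>^2 \<le> (max (?a i) (?a (c v)))^2" by (intro power_mono) auto
        also have "\<dots> \<le> ?G" using alpha_sq_le_gamma[OF n0 c i] alpha_sq_le_gamma[OF n0 c cv] by (simp add: max_def)
        finally show "(?a i - ?a (c v))^2 \<le> ?G" by simp
      qed auto
      also have "\<dots> = ?G * ?G" by (simp add: gamma_def sum_distrib_left)
      also have "\<dots> \<le> (1.2 * g) * (1.2 * g)" using G G0 g by (intro mult_mono) auto
      also have "\<dots> \<le> 3 * g * g" using g by simp
      finally show ?thesis .
    qed
    then have "(\<Sum>v<n. Var (two_choices_vertex n c v) ?a) \<le> (\<Sum>v<n. 3 * g * g)" by (intro sum_mono) auto
    then show ?thesis by (simp add: mult_ac)
  qed
  assume i: "i \<in> {1..k}"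
  have aG: "(?a i)^2 \<le> ?G" by (rule alpha_sq_le_gamma[OF n0 c i])
  have a01: "0 \<le> ?a i" "?a i \<le> 1" by (auto simp: alpha_nonneg alpha_le_1)
  have sum_b: "(\<Sum>v<n. of_bool (c v = i)) = n * ?a i" using n0 by (simp add: alpha_eq_sum)
  have "(\<Sum>v<n. pmf (two_choices_vertex n c v) i) = (\<Sum>v<n. (?a i)^2) + (\<Sum>v<n. of_bool (c v = i)) * (1 - ?G)"
    by (simp only: pmf[OF c i] sum.distrib sum_distrib_right)
  also have "\<dots> = n * ?a i * (1 + ?a i - ?G)"
    unfolding sum_b by (simp add: power2_eq_square algebra_simps)
  finally show "(\<Sum>v<n. pmf (two_choices_vertex n c v) i) = n * ?a i * (1 + ?a i - ?G)" .
  define s where "s = (\<Sum>v<n. pmf (two_choices_vertex n c v) i * (1 - pmf (two_choices_vertex n c v) i))"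
  define p where "p = (?a i)^2 + 1 - ?G"
  have "0 \<le> p" unfolding p_def using G1 zero_le_power2[of "?a i"] by linarith
  moreover have "p \<le> 1" unfolding p_def using aG by linarith
  moreover have "1 - p = ?G - (?a i)^2" by (simp add: p_def)
  ultimately have p: "0 \<le> p" "p \<le> 1" "1 - p = ?G - (?a i)^2" by blast+
  have a2: "(?a i)^2 \<le> 1" using a01 by (simp add: power_le_one)
  \<comment> \<open>A vertex holding \<open>i\<close> has \<open>i\<close> afterwards with
    probability \<open>p\<close>, any other vertex with probability \<open>(?a i)^2\<close>.\<close>
  have split: "pmf (two_choices_vertex n c v) i * (1 - pmf (two_choices_vertex n c v) i)
      = of_bool (c v = i) * (p * (1 - p)) + of_bool (c v \<noteq> i) * ((?a i)^2 * (1 - (?a i)^2))" for v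
    by (simp add: pmf[OF c i] p_def)
  have upper: "s \<le> (\<Sum>v<n. of_bool (c v = i) * ?G + (?a i)^2)"
    unfolding s_def split
  proof (intro sum_mono add_mono)
    fix v
    have "p * (1 - p) \<le> 1 * ?G" using p by (intro mult_mono) auto
    then show "of_bool (c v = i) * (p * (1 - p)) \<le> of_bool (c v = i) * ?G" by (intro mult_left_mono) auto
    have "(?a i)^2 * (1 - (?a i)^2) \<le> (?a i)^2 * 1" by (intro mult_left_mono) auto
    then show "of_bool (c v \<noteq> i) * ((?a i)^2 * (1 - (?a i)^2)) \<le> (?a i)^2" by auto
  qed
  also have "\<dots> = n * ?a i * (?G + ?a i)"
    by (simp only: sum.distrib sum_distrib_right[symmetric] sum_b) (simp add: power2_eq_square algebra_simps)
  finally have upper: "s \<le> n * ?a i * (?G + ?a i)" .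
  assume G: "?G \<le> 1.2 * g"
  have "s \<le> n * ?a i * (3 * (g + ?a i))"
    by (rule order_trans[OF upper]) (use a01 G g in \<open>intro mult_left_mono, auto\<close>)
  then show "(\<Sum>v<n. pmf (two_choices_vertex n c v) i * (1 - pmf (two_choices_vertex n c v) i))
      \<le> 3 * n * ?a i * (g + ?a i)" by (simp add: s_def algebra_simps)
  fix j
  assume Gl: "0.95 * g \<le> ?G" and j: "j \<in> {1..k}" and ij: "i \<noteq> j"
    and ai: "0.7 * g \<le> ?a i" "?a i \<le> 2 * g" and aj: "0.7 * g \<le> ?a j"
  have G6: "?G \<le> 6/7" using gamma_le_6_7[OF n0 c G i j ij ai(1) aj] .
  \<comment> \<open>Here \<open>1 - p\<close> is \<open>?G - (?a i)^2\<close>. For small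
    \<open>g\<close> the square is at most \<open>0.8 * g\<close>, against
    \<open>?G \<ge> 0.95 * g\<close>; for large \<open>g\<close> the opinion \<open>j\<close>
    contributes its square, at least \<open>0.49 * g^2\<close>.\<close>
  have "g / 40 \<le> 1 - p"
  proof (cases "g \<le> 1/5")
    case True
    have "(?a i)^2 \<le> (2 * g)^2" using ai a01 by (intro power_mono) auto
    also have "\<dots> = 4 * g * g" by (simp add: power2_eq_square)
    also have "\<dots> \<le> 4 * g * (1/5)" using True g by (intro mult_left_mono) auto
    finally show ?thesis using Gl g p by simp
  next
    case False
    have "(?a i)^2 + (?a j)^2 = (\<Sum>x\<in>{i, j}. (?a x)^2)" using ij by simp
    also have "\<dots> \<le> ?G" unfolding gamma_def using i j by (intro sum_mono2) auto
    finally have "(?a j)^2 \<le> 1 - p" using p by simp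
    moreover have "(0.7 * g)^2 \<le> (?a j)^2" using aj g by (intro power_mono) auto
    moreover have "(0.7 * g)^2 = 49/100 * (g * g)" by (simp add: power2_eq_square)
    moreover have "g * (1/5) \<le> g * g" using False g by (intro mult_left_mono) auto
    ultimately show ?thesis using g(1) by linarith
  qed
  moreover have "1/7 \<le> p" unfolding p_def using G6 zero_le_power2[of "?a i"] by linarith
  ultimately have pq: "1/7 * (g / 40) \<le> p * (1 - p)" using g p by (intro mult_mono) auto
  \<comment> \<open>The vertices holding \<open>i\<close>, at least \<open>0.7 * g * n\<close> of
    them, already supply enough variance.\<close>
  have "(n * (0.7 * g)) * (1/7 * (g / 40)) \<le> (n * ?a i) * (p * (1 - p))"
    by (rule mult_mono[OF mult_left_mono[OF ai(1)] pq]) (use g a01 in auto)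
  also have "\<dots> = (\<Sum>v<n. of_bool (c v = i) * (p * (1 - p)))"
    by (simp only: sum_distrib_right[symmetric] sum_b)
  also have "\<dots> \<le> s"
    unfolding s_def split using a2 by (intro sum_mono) auto
  finally show "n * g * g / 400 \<le> (\<Sum>v<n. pmf (two_choices_vertex n c v) i * (1 - pmf (two_choices_vertex n c v) i))"
    by (simp add: s_def mult_ac)
qed

theorem theorem2p1:
  "\<exists>C>0.
     (\<exists>C' > 0. \<exists>c > 0. \<exists>D > 0. \<exists>n0. \<forall>n\<ge>n0. \<forall>k\<in>{1..n}. \<forall>c0 :: config.
        (\<forall>v<n. c0 v \<in> {1..k}) \<longrightarrow> gamma n k c0 \<ge> C * ln n / sqrt n \<longrightarrow>
        prob_cons_by n k three_maj_vertex c0 (nat \<lfloor>C' * ln n / gamma n k c0\<rfloor>)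
          \<ge> 1 - D * real n powr (- c))
   \<and> (\<exists>C' > 0. \<exists>c > 0. \<exists>D > 0. \<exists>n0. \<forall>n\<ge>n0. \<forall>k\<in>{1..n}. \<forall>c0 :: config.
        (\<forall>v<n. c0 v \<in> {1..k}) \<longrightarrow> gamma n k c0 \<ge> C * (ln n)^2 / n \<longrightarrow>
        prob_cons_by n k two_choices_vertex c0 (nat \<lfloor>C' * ln n / gamma n k c0\<rfloor>)
          \<ge> 1 - D * real n powr (- c))"
proof -
  \<comment> \<open>One \<open>?C\<close> serves both parts: for 2-Choices it is the constant of
    \<open>large\<close> after cancelling \<open>w = g\<close>, and for 3-Majority squaring the
    threshold even gives \<open>10^36\<close>. \<open>?C'\<close> is the time constant of
    \<open>nohit_consensus\<close>.\<close>
  let ?C = "10^18 :: real" and ?C' = "492 * 10^10 :: real" and ?n0 = "2 * 10^6 :: nat"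
  have n: "n > 0" "real n \<ge> 2 * 10^6" "ln n > 0" if "n \<ge> ?n0" for n :: nat
    using that by auto
  have three: "1 - 5 * real n powr (- 1) \<le> prob_cons_by n k three_maj_vertex c0 (nat \<lfloor>?C' * ln n / gamma n k c0\<rfloor>)"
    if "n \<ge> ?n0" "k \<in> {1..n}" "\<forall>v<n. c0 v \<in> {1..k}" "gamma n k c0 \<ge> ?C * ln n / sqrt n" for n k c0
  proof (rule prob_cons_by_ge[where thr = "?C * ln n / sqrt n" and w = "\<lambda>_. 1"])
    note n = n[OF that(1)]
    show "n > 0" by (rule n)
    show "valid n k c0" using that by (simp add: valid_def)
    show "finite (set_pmf (three_maj_vertex n c v))" for c v by (rule finite_three_maj[OF n(1)])
    show "?C * ln n / sqrt n \<le> gamma n k c0" by (rule that)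
    show thr: "0 < ?C * ln n / sqrt n" using n by simp
    fix g assume g: "?C * ln n / sqrt n \<le> g" "g \<le> 1"
    show "phase n k three_maj_vertex g 1"
    proof (rule phase_three_maj)
      have "(?C * ln n / sqrt n)^2 \<le> g^2" using g(1) thr by (intro power_mono) auto
      then have "(?C * ln n)^2 / n \<le> g^2" by (simp add: power_divide)
      then have "(?C * ln n)^2 \<le> n * g^2" using n(1) by (simp only: pos_divide_le_eq of_nat_0_less_iff mult.commute)
      moreover have "?C * (ln n)^2 \<le> ?C^2 * (ln n)^2" by (intro mult_right_mono) auto
      ultimately show "?C * (ln n)^2 \<le> n * g^2"
        unfolding power_mult_distrib by (rule order_trans[rotated])
      show "0 < g" by (rule less_le_trans[OF thr g(1)])
      show "k \<le> n" using that(2) by simp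
    qed (rule n g)+
  qed
  have two: "1 - 5 * real n powr (- 1) \<le> prob_cons_by n k two_choices_vertex c0 (nat \<lfloor>?C' * ln n / gamma n k c0\<rfloor>)"
    if "n \<ge> ?n0" "k \<in> {1..n}" "\<forall>v<n. c0 v \<in> {1..k}" "gamma n k c0 \<ge> ?C * (ln n)^2 / n" for n k c0
  proof (rule prob_cons_by_ge[where thr = "?C * (ln n)^2 / n" and w = "\<lambda>g. g"])
    note n = n[OF that(1)]
    show "n > 0" by (rule n)
    show "valid n k c0" using that by (simp add: valid_def)
    show "finite (set_pmf (two_choices_vertex n c v))" for c v by (rule finite_two_choices[OF n(1)])
    show "?C * (ln n)^2 / n \<le> gamma n k c0" by (rule that)
    show thr: "0 < ?C * (ln n)^2 / n" using n by simp
    fix g assume g: "?C * (ln n)^2 / n \<le> g" "g \<le> 1"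
    show "phase n k two_choices_vertex g g"
    proof (rule phase_two_choices)
      show "?C * (ln n)^2 \<le> n * g" using g(1) n(1) by (simp only: pos_divide_le_eq of_nat_0_less_iff mult.commute)
      show "0 < g" by (rule less_le_trans[OF thr g(1)])
      show "k \<le> n" using that(2) by simp
    qed (rule n g)+
  qed
  show ?thesis
    by (rule exI[of _ ?C], rule conjI, simp, rule conjI;
        (rule exI[of _ ?C'], rule conjI, simp, rule exI[of _ 1], rule conjI, simp,
         rule exI[of _ 5], rule conjI, simp, rule exI[of _ ?n0], intro allI impI ballI),
        (rule three two; assumption))
qed

end
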